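(* Let $\mathcal{S}$ and $\mathcal{T}$ be finite dimensional operator systems and let $u \in \mathcal{S}\otimes\mathcal{T}$. The following are equivalent: (1) $u$ is positive in $\mathcal{S} \otimes_{\max} \mathcal{T}$. (2) The linear map $\hat{u}\colon \mathcal{S}^d \to \mathcal{T}$ factors through $M_n$ approximately, i.e. there exist nets of completely positive maps $\varphi_\lambda\colon \mathcal{S}^d\to M_{n_\lambda}$ and $\psi_\lambda\colon M_{n_\lambda}\to\mathcal{T}$ such that $\psi_\lambda\circ\varphi_\lambda$ converges to $\hat{u}$ in the point-norm topology.
   Context: An operator system is a unital self-adjoint subspace of $\mathcal{B}(\mathcal{H})$ for a Hilbert space $\mathcal{H}$, with cones $M_n(\mathcal{S})^+$ and unit $1_{\mathcal{S}}$. For $u=\sum_{i} x_i\otimes y_i$ in the algebraic tensor product $\mathcal{S}\otimes\mathcal{T}$, $\hat{u}\colon\mathcal{S}^d\to\mathcal{T}$ is the linear map $\hat{u}(f)=\sum_i f(x_i)y_i$, where $\mathcal{S}^d$ is the linear dual of $\mathcal{S}$. For $\mathcal{S}$ finite dimensional, $\mathcal{S}^d$ is an operator system with matricial cones: $[f_{ij}]\in M_n(\mathcal{S}^d)^+$ iff the map $\mathcal{S}\to M_n$, $s\mapsto[f_{ij}(s)]$, is completely positive (the order unit being a faithful state on $\mathcal{S}$). $M_{n,k}$ denotes complex $n\times k$ matrices, and $P\otimes Q=[p_{ij}\otimes Q]$ is the Kronecker tensor product. Define $$\mathcal{D}_n^{\max}(\mathcal{S},\mathcal{T})=\{A(P\otimes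 Q)A^*: P\in M_k(\mathcal{S})^+,\ Q\in M_m(\mathcal{T})^+,\ A\in M_{n,km},\ k,m\in\mathbb{N}\}.$$ The maximal tensor product $\mathcal{S}\otimes_{\max}\mathcal{T}$ is $\mathcal{S}\otimes\mathcal{T}$ with unit $1_{\mathcal{S}}\otimes 1_{\mathcal{T}}$ and cones $M_n(\mathcal{S}\otimes_{\max}\mathcal{T})^+=\{U\in M_n(\mathcal{S}\otimes\mathcal{T}): \varepsilon (I_n\otimes 1_{\mathcal{S}}\otimes 1_{\mathcal{T}})+U\in\mathcal{D}_n^{\max}(\mathcal{S},\mathcal{T})\ \forall\varepsilon>0\}$. *)

theory Defs
  imports
    "HOL-Analysis.Bounded_Linear_Function"
    "HOL-Library.Poly_Mapping"
    "HOL-Library.Infinite_Typeclass"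
    "Jordan_Normal_Form.Schur_Decomposition"
begin

section \<open>Complex vector spaces and complex Hilbert spaces\<close>

class scaleC =
  fixes scaleC :: "complex \<Rightarrow> 'a \<Rightarrow> 'a" (infixr "*\<^sub>C" 75)

class complex_vector = real_vector + scaleC +
  assumes scaleR_scaleC: "r *\<^sub>R x = complex_of_real r *\<^sub>C x"
    and scaleC_add_right: "a *\<^sub>C (x + y) = a *\<^sub>C x + a *\<^sub>C y"
    and scaleC_add_left: "(a + b) *\<^sub>C x = a *\<^sub>C x + b *\<^sub>C x"
    and scaleC_scaleC: "a *\<^sub>C b *\<^sub>C x = (a * b) *\<^sub>C x"
    and scaleC_one: "1 *\<^sub>C x = x"

class complex_normed_vector = complex_vector + real_normed_vector +
  assumes norm_scaleC: "norm (a *\<^sub>C x) = cmod a * norm x"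

text \<open>The inner product is conjugate linear in its first argument.\<close>

class complex_inner = complex_normed_vector +
  fixes cinner :: "'a \<Rightarrow> 'a \<Rightarrow> complex"
  assumes cinner_commute: "cinner x y = cnj (cinner y x)"
    and cinner_add_right: "cinner x (y + z) = cinner x y + cinner x z"
    and cinner_scaleC_right: "cinner x (a *\<^sub>C y) = a * cinner x y"
    and cinner_ge_zero: "0 \<le> cinner x x"
    and norm_eq_sqrt_cinner: "norm x = sqrt (cmod (cinner x x))"

class chilbert_space = complex_inner + complete_space

global_interpretation complex_vector: vector_space "scaleC :: complex \<Rightarrow> 'a \<Rightarrow> 'a::complex_vector"
  defines csubspace = complex_vector.subspace
    and cspan = complex_vector.span
  by unfold_locales (simp_all add: scaleC_add_right scaleC_add_left scaleC_scaleC scaleC_one)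

definition finite_dimensional :: "'a::complex_vector set \<Rightarrow> bool" where
  "finite_dimensional V \<longleftrightarrow> (\<exists>B. finite B \<and> cspan B = V)"

instantiation complex :: chilbert_space
begin

definition scaleC_complex :: "complex \<Rightarrow> complex \<Rightarrow> complex" where
  "scaleC_complex a x = a * x"

definition cinner_complex :: "complex \<Rightarrow> complex \<Rightarrow> complex" where
  "cinner_complex x y = cnj x * y"

instance
  by standard
    (auto simp: scaleC_complex_def cinner_complex_def algebra_simps scaleR_conv_of_real
      norm_mult less_eq_complex_def)

end

instantiation blinfun :: (real_normed_vector, complex_normed_vector) complex_normed_vector
begin

lift_definition scaleC_blinfun :: "complex \<Rightarrow> 'a \<Rightarrow>\<^sub>L 'b \<Rightarrow> 'a \<Rightarrow>\<^sub>L 'b" is "\<lambda>c f x. c *\<^sub>C f x"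
proof -
  fix c :: complex and f :: "'a \<Rightarrow> 'b"
  assume "bounded_linear f"
  then interpret f: bounded_linear f .
  obtain K where K: "\<And>x. norm (f x) \<le> norm x * K" using f.bounded by blast
  show "bounded_linear (\<lambda>x. c *\<^sub>C f x)"
  proof (rule bounded_linear_intro[where K="cmod c * K"])
    show "norm (c *\<^sub>C f x) \<le> norm x * (cmod c * K)" for x
      using mult_left_mono[OF K[of x], of "cmod c"] by (simp add: norm_scaleC mult_ac)
  qed (simp_all add: f.add f.scaleR scaleC_add_right scaleR_scaleC scaleC_scaleC mult.commute)
qed

instance
proof
  fix r :: real and a b :: complex and x y :: "'a \<Rightarrow>\<^sub>L 'b"
  show "r *\<^sub>R x = complex_of_real r *\<^sub>C x" by transfer (simp add: scaleR_scaleC)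
  show "a *\<^sub>C (x + y) = a *\<^sub>C x + a *\<^sub>C y" by transfer (simp add: scaleC_add_right)
  show "(a + b) *\<^sub>C x = a *\<^sub>C x + b *\<^sub>C x" by transfer (simp add: scaleC_add_left)
  show "a *\<^sub>C b *\<^sub>C x = (a * b) *\<^sub>C x" by transfer (simp add: scaleC_scaleC)
  show "1 *\<^sub>C x = x" by transfer (simp add: scaleC_one)
  have le: "norm (c *\<^sub>C z) \<le> cmod c * norm z" for c and z :: "'a \<Rightarrow>\<^sub>L 'b"
  proof (rule norm_blinfun_bound)
    fix v
    show "norm (blinfun_apply (c *\<^sub>C z) v) \<le> cmod c * norm z * norm v"
      using mult_left_mono[OF norm_blinfun[of z v], of "cmod c"]
      by (simp add: scaleC_blinfun.rep_eq norm_scaleC mult.assoc)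
  qed simp
  show "norm (a *\<^sub>C x) = cmod a * norm x"
  proof (cases "a = 0")
    case True
    then show ?thesis using le[of 0 x] by simp
  next
    case False
    have "x = inverse a *\<^sub>C a *\<^sub>C x"
      using False by transfer (simp add: scaleC_scaleC scaleC_one)
    then have "norm x \<le> cmod (inverse a) * norm (a *\<^sub>C x)" using le[of "inverse a" "a *\<^sub>C x"] by simp
    then have "cmod a * norm x \<le> cmod a * (inverse (cmod a) * norm (a *\<^sub>C x))"
      by (intro mult_left_mono) (simp_all add: norm_inverse)
    also have "\<dots> = norm (a *\<^sub>C x)" using False by simp
    finally have "cmod a * norm x \<le> norm (a *\<^sub>C x)" .
    with le[of a x] show ?thesis by simp
  qed
qed

end


section \<open>Operator systems\<close>

text \<open>A bundled \<open>'h \<Rightarrow>\<^sub>L 'h\<close> is only real linear; \<open>clinear_op\<close> cuts out \<open>B(H)\<close>.\<close>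

definition clinear_op :: "('h::chilbert_space \<Rightarrow>\<^sub>L 'h) \<Rightarrow> bool" where
  "clinear_op X \<longleftrightarrow> (\<forall>c v. blinfun_apply X (c *\<^sub>C v) = c *\<^sub>C blinfun_apply X v)"

definition is_adjoint :: "('h::chilbert_space \<Rightarrow>\<^sub>L 'h) \<Rightarrow> ('h \<Rightarrow>\<^sub>L 'h) \<Rightarrow> bool" where
  "is_adjoint X Y \<longleftrightarrow>
    (\<forall>v w. cinner (blinfun_apply X v) w = cinner v (blinfun_apply Y w))"

definition operator_system :: "('h::chilbert_space \<Rightarrow>\<^sub>L 'h) set \<Rightarrow> bool" where
  "operator_system S \<longleftrightarrow>
    csubspace S \<and> (\<forall>X\<in>S. clinear_op X) \<and> id_blinfun \<in> S \<and> (\<forall>X\<in>S. \<exists>Y\<in>S. is_adjoint X Y)"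

text \<open>\<open>M\<^sub>n(S)\<^sup>+\<close>: matrices over \<open>S\<close> which are positive operators on the \<open>n\<close>-fold direct sum of \<open>H\<close>.\<close>

definition op_cone :: "('h::chilbert_space \<Rightarrow>\<^sub>L 'h) set \<Rightarrow> nat \<Rightarrow> ('h \<Rightarrow>\<^sub>L 'h) mat set" where
  "op_cone S n = {X \<in> carrier_mat n n. elements_mat X \<subseteq> S \<and>
    (\<forall>v :: nat \<Rightarrow> 'h. 0 \<le> (\<Sum>i<n. \<Sum>j<n. cinner (v i) (blinfun_apply (X $$ (i, j)) (v j))))}"


section \<open>Matrix ordered spaces and completely positive maps\<close>

record 'a mo_space =
  mcarrier :: "'a set"
  madd :: "'a \<Rightarrow> 'a \<Rightarrow> 'a"
  msmult :: "complex \<Rightarrow> 'a \<Rightarrow> 'a"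
  mcone :: "nat \<Rightarrow> 'a mat set"

definition mo_linear :: "'a mo_space \<Rightarrow> 'b mo_space \<Rightarrow> ('a \<Rightarrow> 'b) \<Rightarrow> bool" where
  "mo_linear V W \<phi> \<longleftrightarrow>
    (\<forall>x\<in>mcarrier V. \<phi> x \<in> mcarrier W) \<and>
    (\<forall>x\<in>mcarrier V. \<forall>y\<in>mcarrier V. \<phi> (madd V x y) = madd W (\<phi> x) (\<phi> y)) \<and>
    (\<forall>c. \<forall>x\<in>mcarrier V. \<phi> (msmult V c x) = msmult W c (\<phi> x))"

definition completely_positive :: "'a mo_space \<Rightarrow> 'b mo_space \<Rightarrow> ('a \<Rightarrow> 'b) \<Rightarrow> bool" where
  "completely_positive V W \<phi> \<longleftrightarrow>
    mo_linear V W \<phi> \<and> (\<forall>k. \<forall>X\<in>mcone V k. map_mat \<phi> X \<in> mcone W k)"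

definition op_space :: "('h::chilbert_space \<Rightarrow>\<^sub>L 'h) set \<Rightarrow> ('h \<Rightarrow>\<^sub>L 'h) mo_space" where
  "op_space S = \<lparr>mcarrier = S, madd = (+), msmult = scaleC, mcone = op_cone S\<rparr>"

text \<open>\<open>M\<^sub>n\<close> acts on \<open>carrier_vec n\<close>; its cones are those of block matrices which are positive on the
  \<open>k\<close>-fold direct sum of that space. Note that \<open>v \<bullet>c w\<close> is conjugate linear in \<open>w\<close>.\<close>

definition matrix_space :: "nat \<Rightarrow> complex mat mo_space" where
  "matrix_space n = \<lparr>mcarrier = carrier_mat n n, madd = (+), msmult = (\<cdot>\<^sub>m),
    mcone = (\<lambda>k. {X \<in> carrier_mat k k. elements_mat X \<subseteq> carrier_mat n n \<and>
      (\<forall>v. (\<forall>i<k. v i \<in> carrier_vec n) \<longrightarrow>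
        0 \<le> (\<Sum>i<k. \<Sum>j<k. ((X $$ (i, j)) *\<^sub>v v j) \<bullet>c v i))})\<rparr>"

text \<open>Functionals on a carrier are represented by functions vanishing off that carrier.\<close>

definition dual_carrier :: "'a mo_space \<Rightarrow> ('a \<Rightarrow> complex) set" where
  "dual_carrier V = {f. (\<forall>x. x \<notin> mcarrier V \<longrightarrow> f x = 0) \<and>
    (\<forall>x\<in>mcarrier V. \<forall>y\<in>mcarrier V. f (madd V x y) = f x + f y) \<and>
    (\<forall>c. \<forall>x\<in>mcarrier V. f (msmult V c x) = c * f x)}"

definition dual_space :: "'a mo_space \<Rightarrow> ('a \<Rightarrow> complex) mo_space" where
  "dual_space V = \<lparr>mcarrier = dual_carrier V,
    madd = (\<lambda>f g x. f x + g x), msmult = (\<lambda>c f x. c * f x),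
    mcone = (\<lambda>n. {F \<in> carrier_mat n n. elements_mat F \<subseteq> dual_carrier V \<and>
      completely_positive V (matrix_space n) (\<lambda>s. map_mat (\<lambda>f. f s) F)})\<rparr>"


section \<open>The algebraic tensor product\<close>

text \<open>The quotient of the free complex vector space on \<open>'a \<times> 'b\<close> by the bilinear relations.\<close>

definition free_scale :: "complex \<Rightarrow> ('x \<Rightarrow>\<^sub>0 complex) \<Rightarrow> ('x \<Rightarrow>\<^sub>0 complex)" where
  "free_scale c p = Poly_Mapping.map ((*) c) p"

lemma lookup_free_scale [simp]: "Poly_Mapping.lookup (free_scale c p) k = c * Poly_Mapping.lookup p k"
  unfolding free_scale_def by transfer (simp add: when_def)

interpretation free: vector_space "free_scale :: complex \<Rightarrow> ('x \<Rightarrow>\<^sub>0 complex) \<Rightarrow> _"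
  by unfold_locales (auto intro!: poly_mapping_eqI simp: lookup_add algebra_simps)

definition tensor_relations :: "(('a::complex_vector \<times> 'b::complex_vector) \<Rightarrow>\<^sub>0 complex) set" where
  "tensor_relations =
    {Poly_Mapping.single (x + x', y) 1 - Poly_Mapping.single (x, y) 1
      - Poly_Mapping.single (x', y) 1 | x x' y. True} \<union>
    {Poly_Mapping.single (x, y + y') 1 - Poly_Mapping.single (x, y) 1
      - Poly_Mapping.single (x, y') 1 | x y y'. True} \<union>
    {Poly_Mapping.single (c *\<^sub>C x, y) 1 - Poly_Mapping.single (x, y) c | c x y. True} \<union>
    {Poly_Mapping.single (x, c *\<^sub>C y) 1 - Poly_Mapping.single (x, y) c | c x y. True}"

definition tensor_rel ::
  "(('a::complex_vector \<times> 'b::complex_vector) \<Rightarrow>\<^sub>0 complex) \<Rightarrow> (('a \<times> 'b) \<Rightarrow>\<^sub>0 complex) \<Rightarrow> bool" where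
  "tensor_rel p q \<longleftrightarrow> p - q \<in> Modules.module.span free_scale tensor_relations"

lemma tensor_rel_refl: "tensor_rel p p"
  by (simp add: tensor_rel_def free.span_zero)

lemma tensor_rel_sym: "tensor_rel p q \<Longrightarrow> tensor_rel q p"
  unfolding tensor_rel_def using free.span_neg by (metis minus_diff_eq)

lemma tensor_rel_trans: "tensor_rel p q \<Longrightarrow> tensor_rel q r \<Longrightarrow> tensor_rel p r"
  unfolding tensor_rel_def using free.span_add[of "p - q" _ "q - r"] by simp

quotient_type (overloaded) ('a, 'b) tensor =
  "(('a::complex_vector \<times> 'b::complex_vector) \<Rightarrow>\<^sub>0 complex)" / tensor_rel
  by (intro equivpI reflpI sympI transpI)
    (blast intro: tensor_rel_refl tensor_rel_sym tensor_rel_trans)+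

instantiation tensor :: (complex_vector, complex_vector) complex_vector
begin

lift_definition zero_tensor :: "('a, 'b) tensor" is 0 .

lift_definition plus_tensor :: "('a, 'b) tensor \<Rightarrow> ('a, 'b) tensor \<Rightarrow> ('a, 'b) tensor" is "(+)"
  unfolding tensor_rel_def by (simp add: add_diff_add free.span_add)

lift_definition uminus_tensor :: "('a, 'b) tensor \<Rightarrow> ('a, 'b) tensor" is uminus
  unfolding tensor_rel_def by (metis free.span_neg minus_diff_minus)

lift_definition minus_tensor :: "('a, 'b) tensor \<Rightarrow> ('a, 'b) tensor \<Rightarrow> ('a, 'b) tensor" is "(-)"
proof -
  fix p q p' q' :: "('a \<times> 'b) \<Rightarrow>\<^sub>0 complex"
  assume "tensor_rel p q" "tensor_rel p' q'"
  moreover have "p - p' - (q - q') = (p - q) - (p' - q')" by simp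
  ultimately show "tensor_rel (p - p') (q - q')"
    unfolding tensor_rel_def by (simp only: free.span_diff)
qed

lift_definition scaleC_tensor :: "complex \<Rightarrow> ('a, 'b) tensor \<Rightarrow> ('a, 'b) tensor" is free_scale
  unfolding tensor_rel_def by (metis free.span_scale free.scale_right_diff_distrib)

definition scaleR_tensor :: "real \<Rightarrow> ('a, 'b) tensor \<Rightarrow> ('a, 'b) tensor" where
  "scaleR_tensor r x = complex_of_real r *\<^sub>C x"

instance
proof
  fix x y z :: "('a, 'b) tensor" and a b :: complex and r s :: real
  show "x + y + z = x + (y + z)" by transfer (simp add: add.assoc tensor_rel_refl)
  show "x + y = y + x" by transfer (simp add: add.commute tensor_rel_refl)
  show "0 + x = x" by transfer (simp add: tensor_rel_refl)
  show "- x + x = 0" by transfer (simp add: tensor_rel_refl)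
  show "x - y = x + - y" by transfer (simp add: tensor_rel_refl)
  show C1: "a *\<^sub>C (x + y) = a *\<^sub>C x + a *\<^sub>C y" for a :: complex and x y :: "('a, 'b) tensor"
    by transfer (simp add: free.scale_right_distrib tensor_rel_refl)
  show C2: "(a + b) *\<^sub>C x = a *\<^sub>C x + b *\<^sub>C x" for a b :: complex and x :: "('a, 'b) tensor"
    by transfer (simp add: free.scale_left_distrib tensor_rel_refl)
  show C3: "a *\<^sub>C b *\<^sub>C x = (a * b) *\<^sub>C x" for a b :: complex and x :: "('a, 'b) tensor"
    by transfer (simp add: tensor_rel_refl)
  show C4: "1 *\<^sub>C x = x" for x :: "('a, 'b) tensor" by transfer (simp add: tensor_rel_refl)
  show "r *\<^sub>R x = complex_of_real r *\<^sub>C x" by (simp add: scaleR_tensor_def)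
  show "r *\<^sub>R (x + y) = r *\<^sub>R x + r *\<^sub>R y" by (simp add: scaleR_tensor_def C1)
  show "(r + s) *\<^sub>R x = r *\<^sub>R x + s *\<^sub>R x" by (simp add: scaleR_tensor_def C2)
  show "r *\<^sub>R s *\<^sub>R x = (r * s) *\<^sub>R x" by (simp add: scaleR_tensor_def C3)
  show "1 *\<^sub>R x = x" by (simp add: scaleR_tensor_def C4)
qed

end

lift_definition tensor_pure :: "'a::complex_vector \<Rightarrow> 'b::complex_vector \<Rightarrow> ('a, 'b) tensor"
  (infixr "\<otimes>\<^sub>t" 70) is "\<lambda>x y. Poly_Mapping.single (x, y) 1" .

definition tensor_space ::
  "'a::complex_vector set \<Rightarrow> 'b::complex_vector set \<Rightarrow> ('a, 'b) tensor set" where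
  "tensor_space S T = cspan {x \<otimes>\<^sub>t y | x y. x \<in> S \<and> y \<in> T}"

text \<open>The value at \<open>f\<close> of the map induced by \<open>u = (\<Sum>i. x\<^sub>i \<otimes> y\<^sub>i)\<close>, with \<open>x\<^sub>i \<in> S\<close> and \<open>y\<^sub>i \<in> T\<close>.
  By \<open>ex1_tensor_map\<close> below it does not depend on the representation of \<open>u\<close>.\<close>

definition tensor_map ::
  "'a::complex_vector set \<Rightarrow> 'b::complex_vector set \<Rightarrow> ('a, 'b) tensor \<Rightarrow> ('a \<Rightarrow> complex) \<Rightarrow> 'b" where
  "tensor_map S T u f = (THE z. \<exists>ps. set ps \<subseteq> S \<times> T \<and>
    u = (\<Sum>(x, y)\<leftarrow>ps. x \<otimes>\<^sub>t y) \<and> z = (\<Sum>(x, y)\<leftarrow>ps. f x *\<^sub>C y))"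

lemma tensor_pure_scaleC_left: "(c *\<^sub>C x) \<otimes>\<^sub>t y = c *\<^sub>C (x \<otimes>\<^sub>t y)"
proof transfer
  fix c :: complex and x :: 'a and y :: 'b
  have "free_scale c (Poly_Mapping.single (x, y) 1) = Poly_Mapping.single (x, y) c"
    by (rule poly_mapping_eqI) (simp add: lookup_single when_def)
  then show "tensor_rel (Poly_Mapping.single (c *\<^sub>C x, y) 1)
      (free_scale c (Poly_Mapping.single (x, y) 1))"
    unfolding tensor_rel_def tensor_relations_def
    by (simp only:) (rule free.span_base, rule UnI1, rule UnI2, blast)
qed

lemma tensor_space_list:
  assumes S: "csubspace S" and u: "u \<in> tensor_space S T"
  shows "\<exists>ps. set ps \<subseteq> S \<times> T \<and> u = (\<Sum>(x, y)\<leftarrow>ps. x \<otimes>\<^sub>t y)"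
  using u unfolding tensor_space_def
proof (induction rule: complex_vector.span_induct_alt)
  case base
  show ?case by (rule exI[of _ "[]"]) simp
next
  case (step c z w)
  then obtain x y ps where "z = x \<otimes>\<^sub>t y" "x \<in> S" "y \<in> T" "set ps \<subseteq> S \<times> T"
    "w = (\<Sum>(x, y)\<leftarrow>ps. x \<otimes>\<^sub>t y)" by blast
  then show ?case
    by (intro exI[of _ "(c *\<^sub>C x, y) # ps"])
      (simp add: tensor_pure_scaleC_left complex_vector.subspace_scale[OF S])
qed

definition tensor_lift_raw ::
  "('a \<Rightarrow> 'b \<Rightarrow> 'c::complex_vector) \<Rightarrow> (('a \<times> 'b) \<Rightarrow>\<^sub>0 complex) \<Rightarrow> 'c" where
  "tensor_lift_raw B p = (\<Sum>k\<in>Poly_Mapping.keys p. Poly_Mapping.lookup p k *\<^sub>C B (fst k) (snd k))"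

lemma tensor_lift_raw_superset:
  assumes "finite K" "Poly_Mapping.keys p \<subseteq> K"
  shows "tensor_lift_raw B p = (\<Sum>k\<in>K. Poly_Mapping.lookup p k *\<^sub>C B (fst k) (snd k))"
  unfolding tensor_lift_raw_def
  by (rule sum.mono_neutral_left) (use assms in \<open>auto simp: in_keys_iff\<close>)

lemma tensor_lift_raw_linear:
  "tensor_lift_raw B (p + q) = tensor_lift_raw B p + tensor_lift_raw B q"
  "tensor_lift_raw B (p - q) = tensor_lift_raw B p - tensor_lift_raw B q"
  "tensor_lift_raw B (free_scale c p) = c *\<^sub>C tensor_lift_raw B p"
proof -
  let ?K = "Poly_Mapping.keys p \<union> Poly_Mapping.keys q"
  have K: "finite ?K" "Poly_Mapping.keys p \<subseteq> ?K" "Poly_Mapping.keys q \<subseteq> ?K"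
    "Poly_Mapping.keys (p + q) \<subseteq> ?K" "Poly_Mapping.keys (p - q) \<subseteq> ?K"
    "Poly_Mapping.keys (free_scale c p) \<subseteq> ?K"
    by (auto simp: in_keys_iff lookup_add lookup_minus)
  note E = tensor_lift_raw_superset[OF K(1)]
  show "tensor_lift_raw B (p + q) = tensor_lift_raw B p + tensor_lift_raw B q"
    by (simp only: E[OF K(2)] E[OF K(3)] E[OF K(4)] lookup_add scaleC_add_left sum.distrib)
  show "tensor_lift_raw B (p - q) = tensor_lift_raw B p - tensor_lift_raw B q"
    by (simp only: E[OF K(2)] E[OF K(3)] E[OF K(5)] lookup_minus
        complex_vector.scale_left_diff_distrib sum_subtractf)
  show "tensor_lift_raw B (free_scale c p) = c *\<^sub>C tensor_lift_raw B p"
    by (simp only: E[OF K(2)] E[OF K(6)] lookup_free_scale scaleC_scaleC[symmetric]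
        complex_vector.scale_sum_right)
qed

lemma tensor_lift_raw_single: "tensor_lift_raw B (Poly_Mapping.single (x, y) c) = c *\<^sub>C B x y"
  by (simp add: tensor_lift_raw_def)

lemma tensor_lift_raw_cong:
  assumes B: "\<And>x x' y. B (x + x') y = B x y + B x' y" "\<And>x y y'. B x (y + y') = B x y + B x y'"
      "\<And>c x y. B (c *\<^sub>C x) y = c *\<^sub>C B x y" "\<And>c x y. B x (c *\<^sub>C y) = c *\<^sub>C B x y"
    and "tensor_rel p q"
  shows "tensor_lift_raw B p = tensor_lift_raw B q"
proof -
  have "tensor_lift_raw B r = 0" if "r \<in> Modules.module.span free_scale tensor_relations" for r
    using that
  proof (induction rule: free.span_induct_alt)
    case base
    show ?case by (simp add: tensor_lift_raw_def)
  next
    case (step c r s)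
    then show ?case
      by (auto simp: tensor_relations_def tensor_lift_raw_linear tensor_lift_raw_single B scaleC_one)
  qed
  from this[of "p - q"] assms(5) show ?thesis by (simp add: tensor_rel_def tensor_lift_raw_linear)
qed

lemma linear_functional_extend:
  fixes S :: "'a::complex_vector set"
  assumes S: "csubspace S"
    and f: "\<And>x y. x \<in> S \<Longrightarrow> y \<in> S \<Longrightarrow> f (x + y) = f x + f y"
      "\<And>c x. x \<in> S \<Longrightarrow> f (c *\<^sub>C x) = c * f x"
  obtains g :: "'a \<Rightarrow> complex" where "\<And>x y. g (x + y) = g x + g y"
    "\<And>c x. g (c *\<^sub>C x) = c * g x" "\<And>x. x \<in> S \<Longrightarrow> g x = f x"
proof -
  interpret vp: vector_space_pair "scaleC :: complex \<Rightarrow> 'a \<Rightarrow> 'a" "scaleC :: complex \<Rightarrow> complex \<Rightarrow> complex" ..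
  obtain B where B: "B \<subseteq> S" "complex_vector.independent B" "S \<subseteq> cspan B"
    using complex_vector.maximal_independent_subset[of S] by blast
  obtain g where g: "Vector_Spaces.linear scaleC scaleC g" "\<And>x. x \<in> B \<Longrightarrow> g x = f x"
    using vp.linear_independent_extend[OF B(2), of f] by blast
  interpret g: Vector_Spaces.linear scaleC scaleC g by (rule g(1))
  have f0: "f 0 = 0" using f(2)[of 0 0] complex_vector.subspace_0[OF S] by simp
  have "x \<in> S \<and> g x = f x" if "x \<in> cspan B" for x
    using that
  proof (induction rule: complex_vector.span_induct_alt)
    case base
    then show ?case using complex_vector.subspace_0[OF S] by (simp add: f0 g.zero)
  next
    case (step c x y)
    then show ?case
      using B(1) complex_vector.subspace_scale[OF S, of x c]
      by (auto simp: f g.add g.scale g(2) scaleC_complex_def complex_vector.subspace_add[OF S])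
  qed
  with B(3) have "\<And>x. x \<in> S \<Longrightarrow> g x = f x" by blast
  then show ?thesis using that[of g] by (simp add: g.add g.scale scaleC_complex_def)
qed

lemma tensor_map_independent:
  assumes S: "csubspace S"
    and f: "\<And>x y. x \<in> S \<Longrightarrow> y \<in> S \<Longrightarrow> f (x + y) = f x + f y"
      "\<And>c x. x \<in> S \<Longrightarrow> f (c *\<^sub>C x) = c * f x"
    and ps: "set ps \<subseteq> S \<times> T" and qs: "set qs \<subseteq> S \<times> T"
    and eq: "(\<Sum>(x, y)\<leftarrow>ps. x \<otimes>\<^sub>t y) = (\<Sum>(x, y)\<leftarrow>qs. x \<otimes>\<^sub>t y)"
  shows "(\<Sum>(x, y)\<leftarrow>ps. f x *\<^sub>C y) = (\<Sum>(x, y)\<leftarrow>qs. f x *\<^sub>C y)"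
proof -
  obtain g where g: "\<And>x y. g (x + y) = g x + g y" "\<And>c x. g (c *\<^sub>C x) = c * g x"
    "\<And>x. x \<in> S \<Longrightarrow> g x = f x"
    by (rule linear_functional_extend[OF S, of f]) (use f in blast)+
  define B where "B = (\<lambda>x y. g x *\<^sub>C (y :: 'b))"
  define raw :: "('a \<times> 'b) list \<Rightarrow> ('a \<times> 'b) \<Rightarrow>\<^sub>0 complex" where
    "raw rs = (\<Sum>(x, y)\<leftarrow>rs. Poly_Mapping.single (x, y) 1)" for rs
  have abs: "(\<Sum>(x, y)\<leftarrow>rs. x \<otimes>\<^sub>t y) = abs_tensor (raw rs)" for rs
    by (induction rs) (auto simp: raw_def zero_tensor_def tensor_pure.abs_eq plus_tensor.abs_eq)
  have lift: "tensor_lift_raw B (raw rs) = (\<Sum>(x, y)\<leftarrow>rs. f x *\<^sub>C y)" if "set rs \<subseteq> S \<times> T" for rs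
    using that
    by (induction rs)
      (auto simp: raw_def tensor_lift_raw_linear tensor_lift_raw_single B_def g(3) scaleC_one,
        simp add: tensor_lift_raw_def)
  have "tensor_rel (raw ps) (raw qs)"
    using eq unfolding abs by (simp add: tensor.abs_eq_iff)
  then have "tensor_lift_raw B (raw ps) = tensor_lift_raw B (raw qs)"
    by (intro tensor_lift_raw_cong)
      (simp_all add: B_def g scaleC_add_left scaleC_add_right scaleC_scaleC mult.commute)
  then show ?thesis using lift ps qs by simp
qed

lemma ex1_tensor_map:
  assumes S: "csubspace S" and u: "u \<in> tensor_space S T"
    and f: "\<And>x y. x \<in> S \<Longrightarrow> y \<in> S \<Longrightarrow> f (x + y) = f x + f y"
      "\<And>c x. x \<in> S \<Longrightarrow> f (c *\<^sub>C x) = c * f x"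
  shows "\<exists>!z. \<exists>ps. set ps \<subseteq> S \<times> T \<and>
    u = (\<Sum>(x, y)\<leftarrow>ps. x \<otimes>\<^sub>t y) \<and> z = (\<Sum>(x, y)\<leftarrow>ps. f x *\<^sub>C y)"
proof -
  obtain ps where ps: "set ps \<subseteq> S \<times> T" "u = (\<Sum>(x, y)\<leftarrow>ps. x \<otimes>\<^sub>t y)"
    using tensor_space_list[OF S u] by blast
  show ?thesis
  proof (rule ex1I[of _ "\<Sum>(x, y)\<leftarrow>ps. f x *\<^sub>C y"])
    fix z
    assume "\<exists>qs. set qs \<subseteq> S \<times> T \<and>
      u = (\<Sum>(x, y)\<leftarrow>qs. x \<otimes>\<^sub>t y) \<and> z = (\<Sum>(x, y)\<leftarrow>qs. f x *\<^sub>C y)"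
    then obtain qs where qs: "set qs \<subseteq> S \<times> T" "u = (\<Sum>(x, y)\<leftarrow>qs. x \<otimes>\<^sub>t y)"
      "z = (\<Sum>(x, y)\<leftarrow>qs. f x *\<^sub>C y)" by blast
    show "z = (\<Sum>(x, y)\<leftarrow>ps. f x *\<^sub>C y)"
      unfolding qs(3)
      by (rule tensor_map_independent[OF S _ _ qs(1) ps(1)]) (use f ps(2) qs(2) in simp_all)
  qed (use ps in blast)
qed


section \<open>The maximal tensor product\<close>

definition kronecker ::
  "'a::complex_vector mat \<Rightarrow> 'b::complex_vector mat \<Rightarrow> ('a, 'b) tensor mat" where
  "kronecker P Q = mat (dim_row P * dim_row Q) (dim_col P * dim_col Q)
    (\<lambda>(i, j). P $$ (i div dim_row Q, j div dim_col Q) \<otimes>\<^sub>t Q $$ (i mod dim_row Q, j mod dim_col Q))"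

text \<open>The product \<open>A X A\<^sup>*\<close> for a scalar matrix \<open>A\<close> and a square matrix \<open>X\<close> over a vector space.\<close>

definition mat_compress :: "complex mat \<Rightarrow> 'v::complex_vector mat \<Rightarrow> 'v mat" where
  "mat_compress A X = mat (dim_row A) (dim_row A)
    (\<lambda>(i, j). \<Sum>a<dim_row X. \<Sum>b<dim_col X. (A $$ (i, a) * mat_adjoint A $$ (b, j)) *\<^sub>C X $$ (a, b))"

definition max_dcone ::
  "('h::chilbert_space \<Rightarrow>\<^sub>L 'h) set \<Rightarrow> ('k::chilbert_space \<Rightarrow>\<^sub>L 'k) set \<Rightarrow> nat \<Rightarrow>
    ('h \<Rightarrow>\<^sub>L 'h, 'k \<Rightarrow>\<^sub>L 'k) tensor mat set" where
  "max_dcone S T n = {mat_compress A (kronecker P Q) | A P Q k m.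
    0 < k \<and> 0 < m \<and> P \<in> op_cone S k \<and> Q \<in> op_cone T m \<and> A \<in> carrier_mat n (k * m)}"

definition tensor_one :: "('h::chilbert_space \<Rightarrow>\<^sub>L 'h, 'k::chilbert_space \<Rightarrow>\<^sub>L 'k) tensor" where
  "tensor_one = id_blinfun \<otimes>\<^sub>t id_blinfun"

definition max_tensor ::
  "('h::chilbert_space \<Rightarrow>\<^sub>L 'h) set \<Rightarrow> ('k::chilbert_space \<Rightarrow>\<^sub>L 'k) set \<Rightarrow>
    ('h \<Rightarrow>\<^sub>L 'h, 'k \<Rightarrow>\<^sub>L 'k) tensor mo_space" where
  "max_tensor S T = \<lparr>mcarrier = tensor_space S T, madd = (+), msmult = scaleC,
    mcone = (\<lambda>n. {U \<in> carrier_mat n n. elements_mat U \<subseteq> tensor_space S T \<and>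
      (\<forall>\<epsilon>::real. \<epsilon> > 0 \<longrightarrow>
        mat n n (\<lambda>(i, j). if i = j then \<epsilon> *\<^sub>R tensor_one else 0) + U \<in> max_dcone S T n)})\<rparr>"

definition mo_positive :: "'a mo_space \<Rightarrow> 'a \<Rightarrow> bool" where
  "mo_positive V x \<longleftrightarrow> x \<in> mcarrier V \<and> mat 1 1 (\<lambda>_. x) \<in> mcone V 1"


section \<open>Nets\<close>

definition directed_set :: "'i set \<Rightarrow> ('i \<Rightarrow> 'i \<Rightarrow> bool) \<Rightarrow> bool" where
  "directed_set \<Lambda> leq \<longleftrightarrow> \<Lambda> \<noteq> {} \<and> (\<forall>a\<in>\<Lambda>. leq a a) \<and>
    (\<forall>a\<in>\<Lambda>. \<forall>b\<in>\<Lambda>. \<forall>c\<in>\<Lambda>. leq a b \<longrightarrow> leq b c \<longrightarrow> leq a c) \<and>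
    (\<forall>a\<in>\<Lambda>. \<forall>b\<in>\<Lambda>. \<exists>c\<in>\<Lambda>. leq a c \<and> leq b c)"

definition net_filter :: "'i set \<Rightarrow> ('i \<Rightarrow> 'i \<Rightarrow> bool) \<Rightarrow> 'i filter" where
  "net_filter \<Lambda> leq = (INF a\<in>\<Lambda>. principal {b \<in> \<Lambda>. leq a b})"

lemma eventually_net_filter:
  assumes "directed_set \<Lambda> leq"
  shows "eventually P (net_filter \<Lambda> leq) \<longleftrightarrow> (\<exists>a\<in>\<Lambda>. \<forall>b\<in>\<Lambda>. leq a b \<longrightarrow> P b)"
proof -
  have "\<exists>c\<in>\<Lambda>. principal {x \<in> \<Lambda>. leq c x} \<le>
      inf (principal {x \<in> \<Lambda>. leq a x}) (principal {x \<in> \<Lambda>. leq b x})"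
    if ab: "a \<in> \<Lambda>" "b \<in> \<Lambda>" for a b
  proof -
    obtain c where c: "c \<in> \<Lambda>" "leq a c" "leq b c"
      using assms ab unfolding directed_set_def by blast
    have "\<forall>x\<in>\<Lambda>. \<forall>y\<in>\<Lambda>. \<forall>z\<in>\<Lambda>. leq x y \<longrightarrow> leq y z \<longrightarrow> leq x z"
      using assms unfolding directed_set_def by (elim conjE)
    from this[rule_format, OF ab(1) c(1) _ c(2)] this[rule_format, OF ab(2) c(1) _ c(3)]
    have "{x \<in> \<Lambda>. leq c x} \<subseteq> {x \<in> \<Lambda>. leq a x} \<inter> {x \<in> \<Lambda>. leq b x}"
      by auto
    then show ?thesis using c(1) by auto
  qed
  moreover have "\<Lambda> \<noteq> {}" using assms by (simp add: directed_set_def)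
  ultimately show ?thesis
    unfolding net_filter_def by (subst eventually_INF_base) (auto simp: eventually_principal)
qed

end

theory Submission
  imports Defs
begin

text \<open>
  Up to compressing the second factor, an element of the cone \<open>\<D>\<^sub>1\<^sup>m\<^sup>a\<^sup>x(S, T)\<close> is a Schur sum
  \<open>\<Sum>\<^sub>i\<^sub>j P\<^sub>i\<^sub>j \<otimes> Q\<^sub>i\<^sub>j\<close> with \<open>P\<close>, \<open>Q\<close> positive matrices of the same size \<open>n\<close>. The induced map
  \<open>S\<^sup>d \<rightarrow> T\<close> is \<open>f \<mapsto> [f(P\<^sub>i\<^sub>j)]\<close> followed by \<open>M \<mapsto> \<Sum>\<^sub>i\<^sub>j M\<^sub>i\<^sub>j Q\<^sub>i\<^sub>j\<close>, and these are exactly the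
  completely positive maps \<open>S\<^sup>d \<rightarrow> M\<^sub>n\<close> (by biduality) and \<open>M\<^sub>n \<rightarrow> T\<close> (by Choi's theorem). So a
  factorization through \<open>M\<^sub>n\<close> is the same as a Schur sum.
  The approximation passes between the two sides because \<open>1 \<otimes> 1\<close> is an order unit for the cone of
  Schur sums: for self-adjoint \<open>x\<close>, \<open>y\<close> one has
  \<open>\<parallel>x\<parallel>\<parallel>y\<parallel> (1 \<otimes> 1) + x \<otimes> y = 1/2 ((\<parallel>x\<parallel> + x) \<otimes> (\<parallel>y\<parallel> + y) + (\<parallel>x\<parallel> - x) \<otimes> (\<parallel>y\<parallel> - y))\<close>, so the error
  \<open>\<Sum>\<^sub>b b \<otimes> d\<^sub>b\<close>, expanded over a self-adjoint basis of \<open>S\<close>, is absorbed by \<open>\<epsilon> (1 \<otimes> 1)\<close>.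
\<close>

section \<open>Inner products\<close>

lemma cinner_scaleC_left: "cinner (a *\<^sub>C x) y = cnj a * cinner x (y::'a::complex_inner)"
  by (metis cinner_commute cinner_scaleC_right complex_cnj_mult)

lemma cinner_add_left: "cinner (x + y) z = cinner x z + cinner y (z::'a::complex_inner)"
  by (metis cinner_add_right cinner_commute complex_cnj_add)

lemma cinner_zero_right [simp]: "cinner x (0::'a::complex_inner) = 0"
  using cinner_add_right[of x 0 0] by simp

lemma cinner_zero_left [simp]: "cinner (0::'a::complex_inner) x = 0"
  using cinner_add_left[of 0 0 x] by simp

lemma cinner_minus_right: "cinner x (- y) = - cinner x (y::'a::complex_inner)"
  using cinner_add_right[of x y "- y"] by (simp add: eq_neg_iff_add_eq_0 add.commute)

lemma cinner_minus_left: "cinner (- x) y = - cinner x (y::'a::complex_inner)"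
  using cinner_add_left[of x "- x" y] by (simp add: eq_neg_iff_add_eq_0 add.commute)

lemma cinner_diff_right: "cinner x (y - z) = cinner x y - cinner x (z::'a::complex_inner)"
  using cinner_add_right[of x y "- z"] by (simp add: cinner_minus_right)

lemma cinner_diff_left: "cinner (x - y) z = cinner x z - cinner y (z::'a::complex_inner)"
  using cinner_add_left[of x "- y" z] by (simp add: cinner_minus_left)

lemma cinner_sum_right: "cinner x (\<Sum>i\<in>I. f i) = (\<Sum>i\<in>I. cinner x (f i :: 'a::complex_inner))"
  by (induction I rule: infinite_finite_induct) (simp_all add: cinner_add_right)

lemma cinner_sum_left: "cinner (\<Sum>i\<in>I. f i) x = (\<Sum>i\<in>I. cinner (f i :: 'a::complex_inner) x)"
  by (induction I rule: infinite_finite_induct) (simp_all add: cinner_add_left)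

lemma cinner_self: "cinner x x = complex_of_real ((norm x)\<^sup>2)" for x :: "'a::complex_inner"
proof -
  have "cmod (cinner x x) = (norm x)\<^sup>2"
    unfolding norm_eq_sqrt_cinner[of x] by simp
  then show ?thesis
    using cinner_ge_zero[of x] by (simp add: complex_eq_iff less_eq_complex_def cmod_def)
qed

lemma cmod_cinner_le: "cmod (cinner x y) \<le> norm x * norm y" for x y :: "'a::complex_inner"
proof (cases "y = 0")
  case False
  define r where "r = (norm y)\<^sup>2"
  define a where "a = cinner y x"
  have r: "r > 0" using False by (simp add: r_def)
  have yy: "cinner y y = of_real r" by (simp add: cinner_self r_def)
  have xy: "cinner x y = cnj a" by (simp add: a_def cinner_commute[symmetric])
  \<comment> \<open>The component of \<open>x\<close> orthogonal to \<open>y\<close>, multiplied by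
    \<open>r\<close> to avoid a division. Positivity of its square is the Cauchy-Schwarz
    inequality.\<close>
  let ?z = "of_real r *\<^sub>C x - a *\<^sub>C y"
  have "cinner ?z ?z = of_real r * (of_real r * cinner x x - a * cnj a)"
    by (simp add: cinner_diff_left cinner_diff_right cinner_scaleC_left cinner_scaleC_right yy xy
        a_def[symmetric] algebra_simps)
  also have "\<dots> = of_real (r * (r * (norm x)\<^sup>2 - (cmod a)\<^sup>2))"
    by (simp add: cinner_self flip: complex_norm_square)
  finally have "0 \<le> r * (r * (norm x)\<^sup>2 - (cmod a)\<^sup>2)"
    using cinner_ge_zero[of ?z] by (simp add: less_eq_complex_def)
  then have "(cmod a)\<^sup>2 \<le> (norm x * norm y)\<^sup>2"
    using r by (simp add: zero_le_mult_iff r_def power_mult_distrib mult.commute)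
  then have "cmod a \<le> norm x * norm y"
    by (rule power2_le_imp_le) simp
  then show ?thesis by (simp add: xy)
qed simp

text \<open>Over the reals the conjugate linear argument is linear, so the inner product is bilinear
  with bound 1. This supplies its continuity for limits of operators.\<close>

lemma bounded_bilinear_cinner: "bounded_bilinear (cinner :: 'a::complex_inner \<Rightarrow> 'a \<Rightarrow> complex)"
  by (rule bounded_bilinear.intro)
    (auto simp: cinner_add_left cinner_add_right scaleR_scaleC cinner_scaleC_left
      cinner_scaleC_right scaleC_complex_def intro!: exI[of _ 1] cmod_cinner_le)

lemmas blinfun_apply_scaleC = scaleC_blinfun.rep_eq

section \<open>Adjoints: uniqueness, linearity and norm limits\<close>

lemma clinear_opD: "clinear_op X \<Longrightarrow> blinfun_apply X (c *\<^sub>C v) = c *\<^sub>C blinfun_apply X v"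
  by (simp add: clinear_op_def)

lemma is_adjoint_unique:
  assumes "is_adjoint X Y" "is_adjoint X Z"
  shows "Y = Z"
proof (rule blinfun_eqI)
  fix w
  let ?d = "blinfun_apply Y w - blinfun_apply Z w"
  have "cinner ?d ?d = 0"
    using assms unfolding is_adjoint_def by (metis cinner_diff_right eq_iff_diff_eq_0)
  then show "blinfun_apply Y w = blinfun_apply Z w" by (simp add: cinner_self)
qed

lemma is_adjoint_sym: "is_adjoint X Y \<Longrightarrow> is_adjoint Y X"
  unfolding is_adjoint_def by (metis cinner_commute)

lemma is_adjoint_zero: "is_adjoint 0 0"
  by (simp add: is_adjoint_def)

lemma is_adjoint_add: "is_adjoint X Y \<Longrightarrow> is_adjoint X' Y' \<Longrightarrow> is_adjoint (X + X') (Y + Y')"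
  by (simp add: is_adjoint_def blinfun.add_left cinner_add_left cinner_add_right)

lemma is_adjoint_diff: "is_adjoint X Y \<Longrightarrow> is_adjoint X' Y' \<Longrightarrow> is_adjoint (X - X') (Y - Y')"
  by (simp add: is_adjoint_def blinfun.diff_left cinner_diff_left cinner_diff_right)

lemma is_adjoint_scaleC: "is_adjoint X Y \<Longrightarrow> is_adjoint (c *\<^sub>C X) (cnj c *\<^sub>C Y)"
  by (simp add: is_adjoint_def blinfun_apply_scaleC cinner_scaleC_left cinner_scaleC_right)

lemma is_adjoint_sum:
  "(\<And>i. i \<in> I \<Longrightarrow> is_adjoint (X i) (Y i)) \<Longrightarrow> is_adjoint (\<Sum>i\<in>I. X i) (\<Sum>i\<in>I. Y i)"
  by (induction I rule: infinite_finite_induct) (simp_all add: is_adjoint_zero is_adjoint_add)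

text \<open>For fixed vectors, both sides of the adjoint identity depend continuously on the
  operators, so the identity passes to limits along any nontrivial filter.\<close>

lemma is_adjoint_tendsto:
  assumes lim: "(X \<longlongrightarrow> L) F" "(Y \<longlongrightarrow> M) F" and "F \<noteq> bot"
    and "\<forall>\<^sub>F i in F. is_adjoint (X i) (Y i)"
  shows "is_adjoint L M"
  unfolding is_adjoint_def
proof (intro allI)
  fix v w
  have "((\<lambda>i. cinner (blinfun_apply (X i) v) w) \<longlongrightarrow> cinner (blinfun_apply L v) w) F"
    by (intro bounded_bilinear.tendsto[OF bounded_bilinear_cinner] blinfun.tendsto tendsto_const lim)
  then have "((\<lambda>i. cinner v (blinfun_apply (Y i) w)) \<longlongrightarrow> cinner (blinfun_apply L v) w) F"
    by (rule Lim_transform_eventually) (use assms(4) in \<open>auto simp: is_adjoint_def elim: eventually_mono\<close>)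
  moreover have "((\<lambda>i. cinner v (blinfun_apply (Y i) w)) \<longlongrightarrow> cinner v (blinfun_apply M w)) F"
    by (intro bounded_bilinear.tendsto[OF bounded_bilinear_cinner] blinfun.tendsto tendsto_const lim)
  ultimately show "cinner (blinfun_apply L v) w = cinner v (blinfun_apply M w)"
    using \<open>F \<noteq> bot\<close> tendsto_unique by blast
qed


section \<open>Positive kernels\<close>

text \<open>A sesquilinear form with real diagonal is Hermitian by polarization, and families
  supported at one index isolate a single entry. The kernel is operator-valued in form, so scalar
  matrices and matrices over an operator system are both instances.\<close>

lemma positive_kernel_hermitian:
  fixes K :: "'i \<Rightarrow> 'i \<Rightarrow> 'h \<Rightarrow> 'h::complex_inner"
  assumes add: "\<And>i j x y. i \<in> I \<Longrightarrow> j \<in> I \<Longrightarrow> K i j (x + y) = K i j x + K i j y"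
    and scale: "\<And>i j c x. i \<in> I \<Longrightarrow> j \<in> I \<Longrightarrow> K i j (c *\<^sub>C x) = c *\<^sub>C K i j x"
    and pos: "\<And>v. 0 \<le> (\<Sum>i\<in>I. \<Sum>j\<in>I. cinner (v i) (K i j (v j)))"
    and I: "finite I" "i \<in> I" "j \<in> I"
  shows "cinner x (K i j y) = cnj (cinner y (K j i x))"
proof -
  define h where "h v w = (\<Sum>i\<in>I. \<Sum>j\<in>I. cinner (v i) (K i j (w j)))" for v w
  have real: "Im (h v v) = 0" for v
    using pos[of v] by (simp add: h_def less_eq_complex_def)
  have h1: "h (\<lambda>i. v i + v' i) w = h v w + h v' w"
    and h2: "h w (\<lambda>i. v i + v' i) = h w v + h w v'" for v v' w
    by (simp_all add: h_def add cinner_add_left cinner_add_right sum.distrib)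
  have h3: "h (\<lambda>i. c *\<^sub>C v i) w = cnj c * h v w"
    and h4: "h v (\<lambda>i. c *\<^sub>C w i) = c * h v w" for c v w
    by (simp_all add: h_def scale cinner_scaleC_left cinner_scaleC_right sum_distrib_left)
  \<comment> \<open>Reality at \<open>v + w\<close> makes the imaginary parts of
    \<open>h v w\<close> and \<open>h w v\<close> opposite; reality at \<open>v + \<i> w\<close>
    makes their real parts equal.\<close>
  have "h v w = cnj (h w v)" for v w
    using real[of "\<lambda>i. v i + w i"] real[of "\<lambda>i. v i + \<i> *\<^sub>C w i"] real[of v] real[of w]
    by (simp add: h1 h2 h3[of \<i>] h4 complex_eq_iff)
  moreover
  have zero: "K i j 0 = 0" if "i \<in> I" "j \<in> I" for i j
    using add[OF that, of 0 0] by simp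
  have "h (\<lambda>k. if k = a then x else 0) (\<lambda>k. if k = b then y else 0) = cinner x (K a b y)"
    if "a \<in> I" "b \<in> I" for a b x y
  proof -
    have "h (\<lambda>k. if k = a then x else 0) (\<lambda>k. if k = b then y else 0) =
        (\<Sum>i\<in>I. \<Sum>j\<in>I. if i = a then (if j = b then cinner x (K a b y) else 0) else 0)"
      unfolding h_def using zero by (intro sum.cong) auto
    also have "\<dots> = (\<Sum>i\<in>I. if i = a then cinner x (K a b y) else 0)"
      using that I by (intro sum.cong) auto
    finally show ?thesis using that I by simp
  qed
  ultimately show ?thesis using I by metis
qed

section \<open>Gram factorization of positive semidefinite kernels\<close>

lemma sum_kernel_delta:
  assumes "finite I" "a \<in> I" "b \<in> I"
    and "\<And>i. i \<in> I \<Longrightarrow> v i = (if i = a then 1 else 0)" "\<And>j. j \<in> I \<Longrightarrow> w j = (if j = b then 1 else 0)"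
  shows "(\<Sum>i\<in>I. \<Sum>j\<in>I. cnj (v i) * K i j * w j) = K a b"
proof -
  have "(\<Sum>i\<in>I. \<Sum>j\<in>I. cnj (v i) * K i j * w j) =
      (\<Sum>i\<in>I. if i = a then (\<Sum>j\<in>I. if j = b then K a b else 0) else 0)"
    using assms(4,5) by (intro sum.cong refl) (auto intro!: sum.cong sum.neutral)
  then show ?thesis using assms(1-3) by simp
qed

text \<open>Induction on the index set: split off the rank-one term given by the row of the new
  index \<open>x\<close>, and apply the hypothesis to the Schur complement. Index sets are arbitrary
  finite sets because block matrices are later treated as kernels on pairs.\<close>

lemma psd_kernel_factorization:
  fixes K :: "'i \<Rightarrow> 'i \<Rightarrow> complex"
  assumes "finite I" and "\<And>v. 0 \<le> (\<Sum>i\<in>I. \<Sum>j\<in>I. cnj (v i) * K i j * v j)"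
  shows "\<exists>b. \<forall>i\<in>I. \<forall>j\<in>I. K i j = (\<Sum>l\<in>I. b l i * cnj (b l j))"
  using assms
proof (induction I arbitrary: K rule: finite_induct)
  case empty
  show ?case by simp
next
  case (insert x I)
  have herm: "K i j = cnj (K j i)" if "i \<in> insert x I" "j \<in> insert x I" for i j
    using positive_kernel_hermitian[of "insert x I" "\<lambda>i j z. K i j * z" i j 1 1] insert.prems that
      insert.hyps by (simp add: cinner_complex_def scaleC_complex_def algebra_simps)
  have expand: "(\<Sum>i\<in>insert x I. \<Sum>j\<in>insert x I. cnj (v i) * K i j * v j) =
      cnj (v x) * K x x * v x + cnj (v x) * (\<Sum>j\<in>I. K x j * v j) +
      cnj (\<Sum>j\<in>I. K x j * v j) * v x + (\<Sum>i\<in>I. \<Sum>j\<in>I. cnj (v i) * K i j * v j)" for v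
  proof -
    have "(\<Sum>i\<in>I. cnj (v i) * K i x * v x) = cnj (\<Sum>j\<in>I. K x j * v j) * v x"
      unfolding cnj_sum sum_distrib_right
      by (intro sum.cong refl) (subst herm, auto simp: mult_ac)
    then show ?thesis
      using insert.hyps by (simp add: sum.distrib sum_distrib_left mult.assoc)
  qed
  obtain d where d: "K x x = of_real d" "d \<ge> 0"
  proof -
    define v where "v i = (if i = x then 1 else 0 :: complex)" for i
    have "v i = 0" if "i \<in> I" for i using that insert.hyps by (auto simp: v_def)
    then have "(\<Sum>i\<in>insert x I. \<Sum>j\<in>insert x I. cnj (v i) * K i j * v j) = K x x"
      unfolding expand by simp (simp add: v_def)
    then have "0 \<le> K x x" using insert.prems[of v] by simp
    then show ?thesis using that[of "Re (K x x)"] by (auto simp: less_eq_complex_def complex_eq_iff)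
  qed
  \<comment> \<open>With \<open>x / 0 = 0\<close>, this makes the Schur complement \<open>K'\<close> below also work for \<open>d = 0\<close>.\<close>
  have null: "K x j = 0" if "d = 0" "j \<in> I" for j
  proof (rule ccontr)
    assume nz: "K x j \<noteq> 0"
    \<comment> \<open>With \<open>K x x = 0\<close> the form at the \<open>v\<close> below is
      \<open>K j j - 2 * t\<close>, that is \<open>- K j j - 2\<close>, which is negative since
      \<open>K j j\<close> is nonnegative.\<close>
    define t where "t = Re (K j j) + 1"
    define v where "v i = (if i = x then - of_real t * K x j / of_real ((cmod (K x j))\<^sup>2)
      else if i = j then 1 else 0)" for i
    have vj: "v i = (if i = j then 1 else 0)" if "i \<in> I" for i
      using that insert.hyps by (auto simp: v_def)
    have s: "(\<Sum>i\<in>I. K x i * v i) = K x j"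
    proof -
      have "(\<Sum>i\<in>I. K x i * v i) = (\<Sum>i\<in>I. if i = j then K x j else 0)"
        by (intro sum.cong) (auto simp: vj)
      then show ?thesis using \<open>j \<in> I\<close> insert.hyps by simp
    qed
    have q: "(\<Sum>i\<in>I. \<Sum>k\<in>I. cnj (v i) * K i k * v k) = K j j"
      using \<open>j \<in> I\<close> insert.hyps by (intro sum_kernel_delta vj)
    have "cnj (v x) * K x j = - of_real t"
      using nz unfolding v_def complex_norm_square by simp
    moreover from this have "cnj (K x j) * v x = - of_real t"
      by (metis complex_cnj_cnj complex_cnj_complex_of_real complex_cnj_minus complex_cnj_mult mult.commute)
    moreover have "0 \<le> cnj (v x) * K x x * v x + cnj (v x) * K x j + cnj (K x j) * v x + K j j"
      using insert.prems[of v] unfolding expand s q .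
    ultimately have "0 \<le> - of_real t - of_real t + K j j"
      by (simp add: d(1) \<open>d = 0\<close>)
    then have "0 \<le> - 2 * t + Re (K j j)"
      by (simp add: less_eq_complex_def)
    moreover have "0 \<le> Re (K j j)"
    proof -
      have "0 \<le> (\<Sum>i\<in>insert x I. \<Sum>k\<in>insert x I. cnj (if i = j then 1 else 0) * K i k * (if k = j then 1 else 0))"
        by (rule insert.prems)
      also have "\<dots> = K j j"
        using \<open>j \<in> I\<close> insert.hyps by (intro sum_kernel_delta) auto
      finally show ?thesis by (simp add: less_eq_complex_def)
    qed
    ultimately show False by (simp add: t_def)
  qed
  define K' where "K' i j = K i j - K i x * K x j / of_real d" for i j
  have "0 \<le> (\<Sum>i\<in>I. \<Sum>j\<in>I. cnj (v i) * K' i j * v j)" for v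
  proof -
    define s where "s = (\<Sum>j\<in>I. K x j * v j)"
    \<comment> \<open>Completing the square: this value at \<open>x\<close> makes the form of
      \<open>K\<close> at \<open>w\<close> equal to the form of \<open>K'\<close> at
      \<open>v\<close>. For \<open>d = 0\<close> the added value and the correction in
      \<open>K'\<close> are both zero.\<close>
    define w where "w = v(x := - s / of_real d)"
    have w: "w i = v i" if "i \<in> I" for i using that insert.hyps by (auto simp: w_def)
    have "(\<Sum>i\<in>I. \<Sum>j\<in>I. cnj (v i) * (K i x * K x j / of_real d) * v j) = cnj s * s / of_real d"
      unfolding s_def
      unfolding cnj_sum sum_product sum_divide_distrib
      by (intro sum.cong refl) (subst herm, auto simp: mult_ac)
    then have "(\<Sum>i\<in>I. \<Sum>j\<in>I. cnj (v i) * K' i j * v j) =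
        (\<Sum>i\<in>I. \<Sum>j\<in>I. cnj (v i) * K i j * v j) - cnj s * s / of_real d"
      by (simp add: K'_def algebra_simps sum_subtractf)
    also have "\<dots> = (\<Sum>i\<in>insert x I. \<Sum>j\<in>insert x I. cnj (w i) * K i j * w j)"
      unfolding expand d by (simp add: w s_def[symmetric]) (simp add: w_def field_simps)
    finally show ?thesis using insert.prems[of w] by simp
  qed
  from insert.IH[OF this] obtain b where
    b: "\<And>i j. i \<in> I \<Longrightarrow> j \<in> I \<Longrightarrow> K' i j = (\<Sum>l\<in>I. b l i * cnj (b l j))" by blast
  \<comment> \<open>Row \<open>x\<close> is the rank-one factor that was split off; the rows from
    the induction hypothesis are extended by 0 at \<open>x\<close>.\<close>
  define c where "c l i = (if l = x then K i x / of_real (sqrt d) else if i = x then 0 else b l i)" for l i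
  have cx: "c x i * cnj (c x j) = K i x * K x j / of_real d"
    if "i \<in> insert x I" "j \<in> insert x I" for i j
  proof -
    have "complex_of_real (sqrt d) * complex_of_real (sqrt d) = of_real d"
      using d(2) by (simp flip: of_real_mult)
    moreover have "cnj (K j x) = K x j" using herm[of x j] that by simp
    ultimately show ?thesis by (simp add: c_def)
  qed
  have "K i j = (\<Sum>l\<in>insert x I. c l i * cnj (c l j))"
    if ij: "i \<in> insert x I" "j \<in> insert x I" for i j
  proof (cases "i = x \<or> j = x")
    case True
    then have "(\<Sum>l\<in>I. c l i * cnj (c l j)) = 0"
      using insert.hyps by (intro sum.neutral) (auto simp: c_def)
    then have "(\<Sum>l\<in>insert x I. c l i * cnj (c l j)) = K i x * K x j / of_real d"
      using insert.hyps ij by (simp add: cx)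
    moreover have "K i x * K x j / of_real d = K i j"
    proof (cases "d = 0")
      case True
      have "K x j = 0" "K x i = 0"
        using True null[of j] null[of i] d(1) ij by auto
      moreover have "K i x = cnj (K x i)" using herm ij by blast
      ultimately show ?thesis using \<open>i = x \<or> j = x\<close> by auto
    qed (use True d in auto)
    ultimately show ?thesis by simp
  next
    case False
    then have "(\<Sum>l\<in>I. c l i * cnj (c l j)) = K' i j"
      using b[of i j] ij insert.hyps by (auto simp: c_def intro!: sum.cong)
    then show ?thesis using insert.hyps ij by (simp add: cx K'_def)
  qed
  then show ?case by blast
qed


section \<open>Tensors\<close>

lemma tensor_pure_add_left: "(x + x') \<otimes>\<^sub>t y = x \<otimes>\<^sub>t y + x' \<otimes>\<^sub>t y"
proof transfer
  fix x x' :: 'a and y :: 'b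
  have "Poly_Mapping.single (x + x', y) 1 - Poly_Mapping.single (x, y) 1
      - Poly_Mapping.single (x', y) 1 \<in> tensor_relations"
    unfolding tensor_relations_def by blast
  then show "tensor_rel (Poly_Mapping.single (x + x', y) 1)
      (Poly_Mapping.single (x, y) 1 + Poly_Mapping.single (x', y) 1)"
    unfolding tensor_rel_def by (simp add: diff_diff_eq free.span_base)
qed

lemma tensor_pure_add_right: "x \<otimes>\<^sub>t (y + y') = x \<otimes>\<^sub>t y + x \<otimes>\<^sub>t y'"
proof transfer
  fix x :: 'a and y y' :: 'b
  have "Poly_Mapping.single (x, y + y') 1 - Poly_Mapping.single (x, y) 1
      - Poly_Mapping.single (x, y') 1 \<in> tensor_relations"
    unfolding tensor_relations_def by blast
  then show "tensor_rel (Poly_Mapping.single (x, y + y') 1)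
      (Poly_Mapping.single (x, y) 1 + Poly_Mapping.single (x, y') 1)"
    unfolding tensor_rel_def by (simp add: diff_diff_eq free.span_base)
qed

lemma tensor_pure_scaleC_right: "x \<otimes>\<^sub>t (c *\<^sub>C y) = c *\<^sub>C (x \<otimes>\<^sub>t y)"
proof transfer
  fix c :: complex and x :: 'a and y :: 'b
  have "free_scale c (Poly_Mapping.single (x, y) 1) = Poly_Mapping.single (x, y) c"
    by (rule poly_mapping_eqI) (simp add: lookup_single when_def)
  moreover have "Poly_Mapping.single (x, c *\<^sub>C y) 1 - Poly_Mapping.single (x, y) c \<in> tensor_relations"
    unfolding tensor_relations_def by blast
  ultimately show "tensor_rel (Poly_Mapping.single (x, c *\<^sub>C y) 1)
      (free_scale c (Poly_Mapping.single (x, y) 1))"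
    unfolding tensor_rel_def by (simp add: free.span_base)
qed

lemma tensor_pure_zero_left [simp]: "0 \<otimes>\<^sub>t y = 0"
  using tensor_pure_add_left[of 0 0 y] by simp

lemma tensor_pure_zero_right [simp]: "x \<otimes>\<^sub>t 0 = 0"
  using tensor_pure_add_right[of x 0 0] by simp

lemma tensor_pure_minus_left: "(- x) \<otimes>\<^sub>t y = - (x \<otimes>\<^sub>t y)"
  using tensor_pure_add_left[of x "- x" y] by (simp add: eq_neg_iff_add_eq_0 add.commute)

lemma tensor_pure_minus_right: "x \<otimes>\<^sub>t (- y) = - (x \<otimes>\<^sub>t y)"
  using tensor_pure_add_right[of x y "- y"] by (simp add: eq_neg_iff_add_eq_0 add.commute)

lemma tensor_pure_diff_right: "x \<otimes>\<^sub>t (y - y') = x \<otimes>\<^sub>t y - x \<otimes>\<^sub>t y'"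
  using tensor_pure_add_right[of x y "- y'"] by (simp add: tensor_pure_minus_right)

lemma tensor_pure_sum_left: "(\<Sum>i\<in>I. f i) \<otimes>\<^sub>t y = (\<Sum>i\<in>I. f i \<otimes>\<^sub>t y)"
  by (induction I rule: infinite_finite_induct) (simp_all add: tensor_pure_add_left)

lemma tensor_pure_sum_right: "x \<otimes>\<^sub>t (\<Sum>i\<in>I. f i) = (\<Sum>i\<in>I. x \<otimes>\<^sub>t f i)"
  by (induction I rule: infinite_finite_induct) (simp_all add: tensor_pure_add_right)

lemmas tensor_pure_scaleR_left = tensor_pure_scaleC_left[of "complex_of_real r" for r, folded scaleR_scaleC]
lemmas tensor_pure_scaleR_right = tensor_pure_scaleC_right[of _ "complex_of_real r" for r, folded scaleR_scaleC]

section \<open>Evaluating the map induced by a tensor\<close>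

lemma dual_carrier_op_space:
  "f \<in> dual_carrier (op_space S) \<longleftrightarrow> (\<forall>x. x \<notin> S \<longrightarrow> f x = 0) \<and>
    (\<forall>x\<in>S. \<forall>y\<in>S. f (x + y) = f x + f y) \<and> (\<forall>c. \<forall>x\<in>S. f (c *\<^sub>C x) = c * f x)"
  by (simp add: dual_carrier_def op_space_def)

text \<open>Removes the definite description: by \<open>tensor_map_independent\<close>, any one
  representation of the tensor computes the value.\<close>

lemma tensor_map_list:
  fixes S :: "('h::chilbert_space \<Rightarrow>\<^sub>L 'h) set"
  assumes S: "csubspace S" and f: "f \<in> dual_carrier (op_space S)" and ps: "set ps \<subseteq> S \<times> T"
  shows "tensor_map S T (\<Sum>(x, y)\<leftarrow>ps. x \<otimes>\<^sub>t y) f = (\<Sum>(x, y)\<leftarrow>ps. f x *\<^sub>C y)"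
  unfolding tensor_map_def
proof (rule the_equality)
  show "z = (\<Sum>(x, y)\<leftarrow>ps. f x *\<^sub>C y)" if ex: "\<exists>qs. set qs \<subseteq> S \<times> T \<and>
    (\<Sum>(x, y)\<leftarrow>ps. x \<otimes>\<^sub>t y) = (\<Sum>(x, y)\<leftarrow>qs. x \<otimes>\<^sub>t y) \<and> z = (\<Sum>(x, y)\<leftarrow>qs. f x *\<^sub>C y)" for z
  proof -
    obtain qs where qs: "set qs \<subseteq> S \<times> T" "(\<Sum>(x, y)\<leftarrow>ps. x \<otimes>\<^sub>t y) = (\<Sum>(x, y)\<leftarrow>qs. x \<otimes>\<^sub>t y)"
      "z = (\<Sum>(x, y)\<leftarrow>qs. f x *\<^sub>C y)" using ex by blast
    show ?thesis
      unfolding qs(3) by (rule tensor_map_independent[OF S _ _ qs(1) ps(1) qs(2)[symmetric]])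
        (use f in \<open>auto simp: dual_carrier_op_space\<close>)
  qed
qed (use ps in blast)

text \<open>Bridge between the lists of pairs behind \<open>tensor_map\<close> and the double sums
  of matrix entries.\<close>

lemma sum_list_product_upt:
  "(\<Sum>(x, y)\<leftarrow>map (\<lambda>(i, j). (X i j, Y i j)) (List.product [0..<k] [0..<k]). g x y) =
    (\<Sum>i<k. \<Sum>j<k. g (X i j) (Y i j) :: 'a::comm_monoid_add)"
proof -
  have "(\<Sum>(x, y)\<leftarrow>map (\<lambda>(i, j). (X i j, Y i j)) (List.product [0..<k] [0..<k]). g x y) =
      (\<Sum>(i, j)\<leftarrow>List.product [0..<k] [0..<k]. g (X i j) (Y i j))"
    by (simp add: comp_def case_prod_unfold)
  also have "\<dots> = (\<Sum>(i, j)\<in>{..<k} \<times> {..<k}. g (X i j) (Y i j))"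
    by (subst sum_list_distinct_conv_sum_set) (auto simp: distinct_product lessThan_atLeast0)
  finally show ?thesis by (simp add: sum.cartesian_product)
qed


section \<open>Cones of operator systems\<close>

lemma operator_systemD:
  assumes "operator_system S"
  shows "csubspace S" "\<And>X. X \<in> S \<Longrightarrow> clinear_op X" "id_blinfun \<in> S"
    "\<And>X. X \<in> S \<Longrightarrow> \<exists>Y\<in>S. is_adjoint X Y"
  using assms by (auto simp: operator_system_def)

lemma elements_mat_subset_iff:
  "X \<in> carrier_mat n n \<Longrightarrow> elements_mat X \<subseteq> A \<longleftrightarrow> (\<forall>i<n. \<forall>j<n. X $$ (i, j) \<in> A)"
  by (fastforce simp: elements_mat_def)

lemma op_cone_iff:
  "X \<in> op_cone S n \<longleftrightarrow> X \<in> carrier_mat n n \<and> (\<forall>i<n. \<forall>j<n. X $$ (i, j) \<in> S) \<and>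
    (\<forall>v. 0 \<le> (\<Sum>i<n. \<Sum>j<n. cinner (v i) (blinfun_apply (X $$ (i, j)) (v j))))"
  by (auto simp: op_cone_def elements_mat_subset_iff)

lemma op_coneD:
  assumes "X \<in> op_cone S n"
  shows "X \<in> carrier_mat n n" "\<And>i j. i < n \<Longrightarrow> j < n \<Longrightarrow> X $$ (i, j) \<in> S"
    "\<And>v. 0 \<le> (\<Sum>i<n. \<Sum>j<n. cinner (v i) (blinfun_apply (X $$ (i, j)) (v j)))"
  using assms by (auto simp: op_cone_iff)

text \<open>The form of \<open>X\<close> is positive, so polarization applies to the kernel of its
  entries.\<close>

lemma op_cone_is_adjoint:
  assumes S: "operator_system S" and X: "X \<in> op_cone S n" and "i < n" "j < n"
  shows "is_adjoint (X $$ (i, j)) (X $$ (j, i))"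
proof -
  have "cinner x (blinfun_apply (X $$ (j, i)) y) = cnj (cinner y (blinfun_apply (X $$ (i, j)) x))" for x y
    by (rule positive_kernel_hermitian[where I = "{..<n}" and K = "\<lambda>i j. blinfun_apply (X $$ (i, j))"])
      (use assms op_coneD[OF X] operator_systemD(2)[OF S] in \<open>auto simp: blinfun.add_right clinear_opD\<close>)
  then show ?thesis
    unfolding is_adjoint_def by (metis cinner_commute)
qed

text \<open>The coefficients are conjugated so that the result carries
  \<open>\<alpha> a * cnj (\<beta> b)\<close>, the shape of the entries of \<open>A X A*\<close> and
  of a Gram factorization.\<close>

lemma cinner_weighted_sums:
  assumes "clinear_op X"
  shows "cinner (\<Sum>a\<in>A. cnj (\<alpha> a) *\<^sub>C v a) (blinfun_apply X (\<Sum>b\<in>B. cnj (\<beta> b) *\<^sub>C w b)) =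
    (\<Sum>a\<in>A. \<Sum>b\<in>B. \<alpha> a * cnj (\<beta> b) * cinner (v a) (blinfun_apply X (w b)))"
  unfolding blinfun.sum_right clinear_opD[OF assms] cinner_sum_left cinner_sum_right
    cinner_scaleC_left cinner_scaleC_right complex_cnj_cnj
  by (subst sum.swap) (simp add: mult_ac sum_distrib_left)

text \<open>For the scalar matrix \<open>A\<close> with entries \<open>\<alpha> a c\<close>, this is
  the compression \<open>A Q A*\<close>: its form at \<open>v\<close> is the form of
  \<open>Q\<close> at \<open>A* v\<close>, which is the family \<open>w\<close>.\<close>

lemma op_cone_compress:
  fixes \<alpha> :: "nat \<Rightarrow> nat \<Rightarrow> complex" and Q :: "('k::chilbert_space \<Rightarrow>\<^sub>L 'k) mat"
  assumes T: "operator_system T" and Q: "Q \<in> op_cone T m"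
  shows "mat k k (\<lambda>(a, b). \<Sum>c<m. \<Sum>d<m. (\<alpha> a c * cnj (\<alpha> b d)) *\<^sub>C Q $$ (c, d)) \<in> op_cone T k"
  unfolding op_cone_iff
proof (intro conjI allI impI)
  fix v :: "nat \<Rightarrow> 'k"
  define w where "w d = (\<Sum>b<k. cnj (\<alpha> b d) *\<^sub>C v b)" for d
  have "(\<Sum>a<k. \<Sum>b<k. cinner (v a) (blinfun_apply (mat k k (\<lambda>(a, b).
      \<Sum>c<m. \<Sum>d<m. (\<alpha> a c * cnj (\<alpha> b d)) *\<^sub>C Q $$ (c, d)) $$ (a, b)) (v b))) =
      (\<Sum>a<k. \<Sum>b<k. \<Sum>c<m. \<Sum>d<m. \<alpha> a c * cnj (\<alpha> b d) * cinner (v a) (blinfun_apply (Q $$ (c, d)) (v b)))"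
    by (intro sum.cong refl) (simp add: blinfun.sum_left blinfun_apply_scaleC cinner_sum_right cinner_scaleC_right)
  also have "\<dots> = (\<Sum>a<k. \<Sum>c<m. \<Sum>b<k. \<Sum>d<m. \<alpha> a c * cnj (\<alpha> b d) * cinner (v a) (blinfun_apply (Q $$ (c, d)) (v b)))"
    by (intro sum.cong refl sum.swap)
  also have "\<dots> = (\<Sum>c<m. \<Sum>a<k. \<Sum>b<k. \<Sum>d<m. \<alpha> a c * cnj (\<alpha> b d) * cinner (v a) (blinfun_apply (Q $$ (c, d)) (v b)))"
    by (rule sum.swap)
  also have "\<dots> = (\<Sum>c<m. \<Sum>a<k. \<Sum>d<m. \<Sum>b<k. \<alpha> a c * cnj (\<alpha> b d) * cinner (v a) (blinfun_apply (Q $$ (c, d)) (v b)))"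
    by (intro sum.cong refl sum.swap)
  also have "\<dots> = (\<Sum>c<m. \<Sum>d<m. \<Sum>a<k. \<Sum>b<k. \<alpha> a c * cnj (\<alpha> b d) * cinner (v a) (blinfun_apply (Q $$ (c, d)) (v b)))"
    by (intro sum.cong refl sum.swap)
  also have "\<dots> = (\<Sum>c<m. \<Sum>d<m. cinner (w c) (blinfun_apply (Q $$ (c, d)) (w d)))"
    using op_coneD(2)[OF Q] operator_systemD(2)[OF T]
    by (intro sum.cong refl) (simp add: w_def cinner_weighted_sums)
  finally show "0 \<le> (\<Sum>a<k. \<Sum>b<k. cinner (v a) (blinfun_apply (mat k k (\<lambda>(a, b).
      \<Sum>c<m. \<Sum>d<m. (\<alpha> a c * cnj (\<alpha> b d)) *\<^sub>C Q $$ (c, d)) $$ (a, b)) (v b)))"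
    using op_coneD(3)[OF Q, of w] by simp
qed (auto intro!: complex_vector.subspace_sum complex_vector.subspace_scale operator_systemD(1)[OF T]
    op_coneD(2)[OF Q])

lemma op_cone_1: "x \<in> S \<Longrightarrow> (\<And>v. 0 \<le> cinner v (blinfun_apply x v)) \<Longrightarrow> mat 1 1 (\<lambda>_. x) \<in> op_cone S 1"
  by (simp add: op_cone_iff)

lemma sum_lessThan_add: "(\<Sum>i<m + n. f i) = (\<Sum>i<m. f i) + (\<Sum>i<n. f (m + i) :: 'a::comm_monoid_add)" for m n :: nat
  by (induction n) (simp_all add: add.assoc)

text \<open>Splits an index of a Kronecker product into block number and offset, the encoding undone
  by \<open>div\<close> and \<open>mod\<close> in \<open>kronecker\<close>.\<close>

lemma sum_lessThan_mult:
  "(\<Sum>p<k * m. f p) = (\<Sum>a<k. \<Sum>c<m. f (a * m + c) :: 'a::comm_monoid_add)" for k m :: nat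
  by (induction k) (simp_all add: sum_lessThan_add add.commute[of m])

definition direct_sum_mat :: "'a::zero mat \<Rightarrow> 'a mat \<Rightarrow> nat \<Rightarrow> nat \<Rightarrow> 'a mat" where
  "direct_sum_mat X Y k l = mat (k + l) (k + l) (\<lambda>(i, j).
    if i < k \<and> j < k then X $$ (i, j) else if k \<le> i \<and> k \<le> j then Y $$ (i - k, j - k) else 0)"

lemma sum_direct_sum_mat:
  assumes "\<And>i j. g i j 0 = (0 :: 'b::comm_monoid_add)"
  shows "(\<Sum>i<k + l. \<Sum>j<k + l. g i j (direct_sum_mat X Y k l $$ (i, j))) =
    (\<Sum>i<k. \<Sum>j<k. g i j (X $$ (i, j))) + (\<Sum>i<l. \<Sum>j<l. g (k + i) (k + j) (Y $$ (i, j)))"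
  by (simp add: sum_lessThan_add direct_sum_mat_def assms cong: sum.cong_simp)

lemma op_cone_direct_sum:
  assumes "0 \<in> S" and X: "X \<in> op_cone S k" and Y: "Y \<in> op_cone S l"
  shows "direct_sum_mat X Y k l \<in> op_cone S (k + l)"
  unfolding op_cone_iff
proof (intro conjI allI impI)
  fix v
  show "0 \<le> (\<Sum>i<k + l. \<Sum>j<k + l. cinner (v i) (blinfun_apply (direct_sum_mat X Y k l $$ (i, j)) (v j)))"
    using op_coneD(3)[OF X, of v] op_coneD(3)[OF Y, of "\<lambda>i. v (k + i)"]
    by (subst sum_direct_sum_mat) simp_all
qed (use assms op_coneD(2)[OF X] op_coneD(2)[OF Y] in \<open>auto simp: direct_sum_mat_def\<close>)


section \<open>The cone of the maximal tensor product\<close>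

text \<open>The first level of \<open>max_dcone\<close> with factors of equal size and the
  compression fixed to the row vector \<Sum> e_i \<otimes> e_i.\<close>

definition schur_cone :: "('h::chilbert_space \<Rightarrow>\<^sub>L 'h) set \<Rightarrow> ('k::chilbert_space \<Rightarrow>\<^sub>L 'k) set \<Rightarrow>
    ('h \<Rightarrow>\<^sub>L 'h, 'k \<Rightarrow>\<^sub>L 'k) tensor set" where
  "schur_cone S T = {\<Sum>i<k. \<Sum>j<k. P $$ (i, j) \<otimes>\<^sub>t Q $$ (i, j) | k P Q.
    0 < k \<and> P \<in> op_cone S k \<and> Q \<in> op_cone T k}"

lemma mat_adjoint_index:
  "i < dim_col A \<Longrightarrow> j < dim_row A \<Longrightarrow> mat_adjoint A $$ (i, j) = cnj (A $$ (j, i))"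
  for A :: "complex mat"
  by (simp add: mat_adjoint_def mat_of_rows_index)

text \<open>A row of length \<open>k * m\<close> is a \<open>k\<close> by \<open>m\<close> matrix
  \<open>\<alpha>\<close>, and compressing by the row gives the Schur sum of \<open>P\<close> with
  the \<open>k\<close> by \<open>k\<close> compression of \<open>Q\<close> by
  \<open>\<alpha>\<close>. The compression thus moves into the second factor, where it preserves
  positivity.\<close>

lemma max_dcone_1_iff:
  fixes S :: "('h::chilbert_space \<Rightarrow>\<^sub>L 'h) set" and T :: "('k::chilbert_space \<Rightarrow>\<^sub>L 'k) set"
  assumes T: "operator_system T"
  shows "mat 1 1 (\<lambda>_. w) \<in> max_dcone S T 1 \<longleftrightarrow> w \<in> schur_cone S T"
proof
  assume "mat 1 1 (\<lambda>_. w) \<in> max_dcone S T 1"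
  then obtain A P Q k m where eq: "mat 1 1 (\<lambda>_. w) = mat_compress A (kronecker P Q)" and "0 < k" "0 < m"
    and P: "P \<in> op_cone S k" and Q: "Q \<in> op_cone T m" and A: "A \<in> carrier_mat 1 (k * m)"
    unfolding max_dcone_def by blast
  define \<alpha> where "\<alpha> a c = A $$ (0, a * m + c)" for a c
  have idx: "a * m + c < k * m" if "a < k" "c < m" for a c
  proof -
    have "a * m + c < Suc a * m" using that by simp
    also have "\<dots> \<le> k * m" using that by (intro mult_right_mono) auto
    finally show ?thesis .
  qed
  have "w = mat_compress A (kronecker P Q) $$ (0, 0)"
    unfolding eq[symmetric] by simp
  also have "\<dots> = (\<Sum>a<k. \<Sum>c<m. \<Sum>b<k. \<Sum>d<m.
      (\<alpha> a c * cnj (\<alpha> b d)) *\<^sub>C (P $$ (a, b) \<otimes>\<^sub>t Q $$ (c, d)))"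
    using A op_coneD(1)[OF P] op_coneD(1)[OF Q] idx
    by (simp add: mat_compress_def kronecker_def sum_lessThan_mult mat_adjoint_index \<alpha>_def cong: sum.cong_simp)
  also have "\<dots> = (\<Sum>a<k. \<Sum>b<k. P $$ (a, b) \<otimes>\<^sub>t
      (\<Sum>c<m. \<Sum>d<m. (\<alpha> a c * cnj (\<alpha> b d)) *\<^sub>C Q $$ (c, d)))"
  proof (rule sum.cong[OF refl])
    fix a
    show "(\<Sum>c<m. \<Sum>b<k. \<Sum>d<m. (\<alpha> a c * cnj (\<alpha> b d)) *\<^sub>C (P $$ (a, b) \<otimes>\<^sub>t Q $$ (c, d))) =
        (\<Sum>b<k. P $$ (a, b) \<otimes>\<^sub>t (\<Sum>c<m. \<Sum>d<m. (\<alpha> a c * cnj (\<alpha> b d)) *\<^sub>C Q $$ (c, d)))"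
      by (subst sum.swap) (simp add: tensor_pure_sum_right tensor_pure_scaleC_right)
  qed
  finally have "w = (\<Sum>a<k. \<Sum>b<k. P $$ (a, b) \<otimes>\<^sub>t
      mat k k (\<lambda>(a, b). \<Sum>c<m. \<Sum>d<m. (\<alpha> a c * cnj (\<alpha> b d)) *\<^sub>C Q $$ (c, d)) $$ (a, b))"
    by (simp cong: sum.cong_simp)
  then show "w \<in> schur_cone S T"
    unfolding schur_cone_def using op_cone_compress[OF T Q, of k \<alpha>] P \<open>0 < k\<close> by blast
next
  assume "w \<in> schur_cone S T"
  then obtain k P Q where w: "w = (\<Sum>i<k. \<Sum>j<k. P $$ (i, j) \<otimes>\<^sub>t Q $$ (i, j))" and "0 < k"
    and P: "P \<in> op_cone S k" and Q: "Q \<in> op_cone T k"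
    unfolding schur_cone_def by blast
  \<comment> \<open>The entry is 1 exactly at the positions \<open>a * k + a\<close>, so the
    compression keeps only the terms with \<open>a = c\<close> and \<open>b = d\<close>.\<close>
  define A :: "complex mat" where "A = mat 1 (k * k) (\<lambda>(_, p). if p div k = p mod k then 1 else 0)"
  have idx: "a * k + c < k * k" if "a < k" "c < k" for a c
  proof -
    have "a * k + c < Suc a * k" using that by simp
    also have "\<dots> \<le> k * k" using that by (intro mult_right_mono) auto
    finally show ?thesis .
  qed
  have "mat_compress A (kronecker P Q) $$ (0, 0) = (\<Sum>a<k. \<Sum>c<k. \<Sum>b<k. \<Sum>d<k.
      ((if a = c then 1 else 0) * cnj (if b = d then 1 else 0)) *\<^sub>C (P $$ (a, b) \<otimes>\<^sub>t Q $$ (c, d)))"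
    using op_coneD(1)[OF P] op_coneD(1)[OF Q] idx
    by (simp add: mat_compress_def kronecker_def sum_lessThan_mult mat_adjoint_index A_def
        del: mult_eq_if cong: sum.cong_simp)
  also have "\<dots> = (\<Sum>a<k. \<Sum>c<k. \<Sum>b<k. \<Sum>d<k.
      if a = c then if b = d then P $$ (a, b) \<otimes>\<^sub>t Q $$ (c, d) else 0 else 0)"
    by (intro sum.cong refl) (auto simp: scaleC_one)
  also have "\<dots> = (\<Sum>a<k. \<Sum>c<k. if a = c then (\<Sum>b<k. P $$ (a, b) \<otimes>\<^sub>t Q $$ (c, b)) else 0)"
    by (intro sum.cong refl) auto
  also have "\<dots> = w" by (simp add: w)
  finally have "mat 1 1 (\<lambda>_. w) = mat_compress A (kronecker P Q)"
    by (intro eq_matI) (auto simp: mat_compress_def A_def)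
  moreover have "A \<in> carrier_mat 1 (k * k)" by (simp add: A_def)
  ultimately show "mat 1 1 (\<lambda>_. w) \<in> max_dcone S T 1"
    unfolding max_dcone_def using P Q \<open>0 < k\<close> by blast
qed

section \<open>Cone operations on Schur sums and the order unit\<close>

lemma schur_cone_pure:
  assumes "x \<in> S" "y \<in> T" "\<And>v. 0 \<le> cinner v (blinfun_apply x v)" "\<And>v. 0 \<le> cinner v (blinfun_apply y v)"
  shows "x \<otimes>\<^sub>t y \<in> schur_cone S T"
proof -
  have "x \<otimes>\<^sub>t y = (\<Sum>i<1. \<Sum>j<1. mat 1 1 (\<lambda>_. x) $$ (i, j) \<otimes>\<^sub>t mat 1 1 (\<lambda>_. y) $$ (i, j))" by simp
  moreover have "(0::nat) < 1" by simp
  ultimately show ?thesis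
    unfolding schur_cone_def using op_cone_1[OF assms(1,3)] op_cone_1[OF assms(2,4)] by blast
qed

text \<open>Direct sums are taken in both factors at once, so the off-diagonal blocks contribute
  only \<open>0 \<otimes>\<^sub>t 0\<close>.\<close>

lemma schur_cone_add:
  assumes "0 \<in> S" "0 \<in> T" "w \<in> schur_cone S T" "w' \<in> schur_cone S T"
  shows "w + w' \<in> schur_cone S T"
proof -
  obtain k P Q where w: "w = (\<Sum>i<k. \<Sum>j<k. P $$ (i, j) \<otimes>\<^sub>t Q $$ (i, j))" "0 < k"
    "P \<in> op_cone S k" "Q \<in> op_cone T k" using assms(3) unfolding schur_cone_def by blast
  obtain l P' Q' where w': "w' = (\<Sum>i<l. \<Sum>j<l. P' $$ (i, j) \<otimes>\<^sub>t Q' $$ (i, j))" "0 < l"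
    "P' \<in> op_cone S l" "Q' \<in> op_cone T l" using assms(4) unfolding schur_cone_def by blast
  have "w + w' = (\<Sum>i<k + l. \<Sum>j<k + l. direct_sum_mat P P' k l $$ (i, j) \<otimes>\<^sub>t direct_sum_mat Q Q' k l $$ (i, j))"
    by (subst sum_direct_sum_mat) (simp_all add: w w' direct_sum_mat_def cong: sum.cong_simp)
  then show ?thesis
    unfolding schur_cone_def
    using op_cone_direct_sum[OF assms(1) w(3) w'(3)] op_cone_direct_sum[OF assms(2) w(4) w'(4)] w(2)
    by blast
qed

lemma schur_cone_sum:
  assumes "0 \<in> S" "0 \<in> T" "\<And>i. i \<in> I \<Longrightarrow> f i \<in> schur_cone S T"
  shows "(\<Sum>i\<in>I. f i) \<in> schur_cone S T"
proof -
  have "0 \<in> schur_cone S T"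
    using schur_cone_pure[of 0 S 0 T] assms(1,2) by simp
  then show ?thesis
    using assms(3)
    by (induction I rule: infinite_finite_induct) (simp_all add: schur_cone_add[OF assms(1,2)])
qed

text \<open>Self-adjointness makes the form of \<open>x\<close> real, and Cauchy-Schwarz bounds it
  below by -r times the squared norm of \<open>v\<close>.\<close>

lemma norm_shift_positive:
  assumes "is_adjoint x x" "norm x \<le> r"
  shows "0 \<le> cinner v (blinfun_apply (r *\<^sub>R id_blinfun + x) v)"
proof -
  let ?z = "cinner v (blinfun_apply x v)"
  have "cnj ?z = ?z"
    using assms(1) unfolding is_adjoint_def by (metis cinner_commute)
  then have "Im ?z = 0" by (simp add: complex_eq_iff)
  have "cmod ?z \<le> norm v * (norm x * norm v)"
    using cmod_cinner_le[of v "blinfun_apply x v"] norm_blinfun[of x v]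
    by (meson mult_left_mono norm_ge_zero order_trans)
  also have "\<dots> \<le> norm v * (r * norm v)"
    using assms(2) by (intro mult_left_mono mult_right_mono) auto
  finally have "- Re ?z \<le> r * (norm v)\<^sup>2"
    using abs_Re_le_cmod[of ?z] by (simp add: power2_eq_square mult_ac)
  moreover have "blinfun_apply (r *\<^sub>R id_blinfun + x) v = complex_of_real r *\<^sub>C v + blinfun_apply x v"
    by (simp add: blinfun.add_left blinfun.scaleR_left) (simp add: scaleR_scaleC)
  ultimately show ?thesis
    using \<open>Im ?z = 0\<close>
    by (simp add: cinner_add_right cinner_scaleC_right cinner_self less_eq_complex_def flip: of_real_power)
qed

lemma schur_cone_one:
  assumes S: "operator_system S" and T: "operator_system T" and "0 \<le> r"
  shows "r *\<^sub>R tensor_one \<in> schur_cone S T"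
proof -
  have "r *\<^sub>R id_blinfun \<in> S"
    using operator_systemD[OF S] by (simp add: scaleR_scaleC complex_vector.subspace_scale)
  then have "(r *\<^sub>R id_blinfun) \<otimes>\<^sub>t id_blinfun \<in> schur_cone S T"
    using operator_systemD(3)[OF T] norm_shift_positive[of 0 r] \<open>0 \<le> r\<close>
    by (intro schur_cone_pure) (auto simp: is_adjoint_zero cinner_ge_zero)
  then show ?thesis by (simp add: tensor_one_def tensor_pure_scaleR_left)
qed

lemma cinner_half_positive:
  fixes x :: "'h::chilbert_space \<Rightarrow>\<^sub>L 'h"
  assumes "0 \<le> cinner v (blinfun_apply x v)"
  shows "0 \<le> cinner v (blinfun_apply ((1 / 2 :: real) *\<^sub>R x) v)"
  using assms by (simp add: scaleR_scaleC blinfun_apply_scaleC cinner_scaleC_right less_eq_complex_def)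

lemma schur_cone_order_unit:
  assumes S: "operator_system S" and T: "operator_system T"
    and x: "x \<in> S" "is_adjoint x x" and y: "y \<in> T" "is_adjoint y y"
  shows "(norm x * norm y) *\<^sub>R tensor_one + x \<otimes>\<^sub>t y \<in> schur_cone S T"
proof -
  let ?h = "1 / 2 :: real"
  note sub = operator_systemD(1)[OF S] operator_systemD(1)[OF T]
  define p q p' q' where "p = norm x *\<^sub>R id_blinfun + x" and "q = norm y *\<^sub>R id_blinfun + y"
    and "p' = norm x *\<^sub>R id_blinfun + - x" and "q' = norm y *\<^sub>R id_blinfun + - y"
  note defs = p_def q_def p'_def q'_def
  have adj: "is_adjoint (- x) (- x)" "is_adjoint (- y) (- y)"
    using is_adjoint_diff[OF is_adjoint_zero x(2)] is_adjoint_diff[OF is_adjoint_zero y(2)] by simp_all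
  have in_S: "p \<in> S" "p' \<in> S" and in_T: "q \<in> T" "q' \<in> T"
    unfolding defs scaleR_scaleC using x y sub operator_systemD(3)[OF S] operator_systemD(3)[OF T]
    by (auto intro!: complex_vector.subspace_add complex_vector.subspace_scale complex_vector.subspace_neg complex_vector.subspace_diff)
  have pos: "0 \<le> cinner v (blinfun_apply p v)" "0 \<le> cinner v (blinfun_apply p' v)"
      "0 \<le> cinner v' (blinfun_apply q v')" "0 \<le> cinner v' (blinfun_apply q' v')" for v v'
    unfolding defs by (rule norm_shift_positive; use x y adj in simp)+
  \<comment> \<open>The mixed terms of the two products have opposite signs and cancel. The factor
    1/2 is put inside the first leg so that each summand is a pure tensor of positive
    operators.\<close>
  have "(?h *\<^sub>R p) \<otimes>\<^sub>t q + (?h *\<^sub>R p') \<otimes>\<^sub>t q' \<in> schur_cone S T"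
    using in_S in_T sub
    by (intro schur_cone_add schur_cone_pure cinner_half_positive pos)
      (auto simp: scaleR_scaleC complex_vector.subspace_scale complex_vector.subspace_0)
  moreover have "(?h *\<^sub>R p) \<otimes>\<^sub>t q + (?h *\<^sub>R p') \<otimes>\<^sub>t q' = (norm x * norm y) *\<^sub>R tensor_one + x \<otimes>\<^sub>t y"
    unfolding defs tensor_one_def tensor_pure_add_left tensor_pure_add_right tensor_pure_minus_left
      tensor_pure_minus_right tensor_pure_scaleR_left tensor_pure_scaleR_right scaleR_add_right
    by (simp add: algebra_simps flip: scaleR_add_left)
  ultimately show ?thesis by simp
qed


section \<open>Completely positive maps\<close>

lemma mult_mat_vec_cscalar_prod:
  fixes M :: "complex mat"
  assumes "M \<in> carrier_mat n n" "v \<in> carrier_vec n" "w \<in> carrier_vec n"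
  shows "(M *\<^sub>v v) \<bullet>c w = (\<Sum>i<n. \<Sum>j<n. M $$ (i, j) * v $ j * cnj (w $ i))"
  using assms
  by (simp add: scalar_prod_def mult_mat_vec_def sum_distrib_right atLeast0LessThan cong: sum.cong_simp)

text \<open>Scalar families \<open>w i a\<close> replace families of vectors in
  \<open>carrier_vec n\<close>, so that positivity becomes that of a scalar kernel on pairs of
  indices.\<close>

lemma matrix_cone_iff:
  "X \<in> mcone (matrix_space n) k \<longleftrightarrow>
    X \<in> carrier_mat k k \<and> (\<forall>i<k. \<forall>j<k. X $$ (i, j) \<in> carrier_mat n n) \<and>
    (\<forall>w. 0 \<le> (\<Sum>i<k. \<Sum>j<k. \<Sum>a<n. \<Sum>b<n. X $$ (i, j) $$ (a, b) * w j b * cnj (w i a)))"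
  (is "_ \<longleftrightarrow> ?carrier \<and> ?entries \<and> ?pos")
proof (cases "?carrier \<and> ?entries")
  case True
  have form: "(\<Sum>i<k. \<Sum>j<k. ((X $$ (i, j)) *\<^sub>v v j) \<bullet>c v i) =
      (\<Sum>i<k. \<Sum>j<k. \<Sum>a<n. \<Sum>b<n. X $$ (i, j) $$ (a, b) * v j $ b * cnj (v i $ a))"
    if "\<forall>i<k. v i \<in> carrier_vec n" for v
    using that True by (intro sum.cong refl mult_mat_vec_cscalar_prod) auto
  have "(\<forall>v. (\<forall>i<k. v i \<in> carrier_vec n) \<longrightarrow> 0 \<le> (\<Sum>i<k. \<Sum>j<k. ((X $$ (i, j)) *\<^sub>v v j) \<bullet>c v i)) \<longleftrightarrow> ?pos"
  proof (intro iffI allI impI)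
    fix w
    assume L: "\<forall>v. (\<forall>i<k. v i \<in> carrier_vec n) \<longrightarrow> 0 \<le> (\<Sum>i<k. \<Sum>j<k. ((X $$ (i, j)) *\<^sub>v v j) \<bullet>c v i)"
    show "0 \<le> (\<Sum>i<k. \<Sum>j<k. \<Sum>a<n. \<Sum>b<n. X $$ (i, j) $$ (a, b) * w j b * cnj (w i a))"
      using L[rule_format, of "\<lambda>i. vec n (w i)"] form[of "\<lambda>i. vec n (w i)"] by (simp cong: sum.cong_simp)
  next
    fix v :: "nat \<Rightarrow> complex vec"
    assume R: ?pos and v: "\<forall>i<k. v i \<in> carrier_vec n"
    show "0 \<le> (\<Sum>i<k. \<Sum>j<k. ((X $$ (i, j)) *\<^sub>v v j) \<bullet>c v i)"
      using R[rule_format, of "\<lambda>i a. v i $ a"] form[OF v] by simp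
  qed
  moreover have "elements_mat X \<subseteq> carrier_mat n n"
    using True elements_mat_subset_iff[of X k] by blast
  ultimately show ?thesis using True by (simp add: matrix_space_def)
qed (auto simp: matrix_space_def elements_mat_subset_iff)

lemma matrix_space_simps:
  "mcarrier (matrix_space n) = carrier_mat n n" "madd (matrix_space n) = (+)" "msmult (matrix_space n) = (\<cdot>\<^sub>m)"
  by (simp_all add: matrix_space_def)

lemma op_space_simps:
  "mcarrier (op_space S) = S" "madd (op_space S) = (+)" "msmult (op_space S) = scaleC" "mcone (op_space S) = op_cone S"
  by (simp_all add: op_space_def)

lemma dual_space_simps:
  "mcarrier (dual_space V) = dual_carrier V" "madd (dual_space V) = (\<lambda>f g x. f x + g x)"
  "msmult (dual_space V) = (\<lambda>c f x. c * f x)"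
  by (simp_all add: dual_space_def)

lemma dual_cone_iff:
  "F \<in> mcone (dual_space V) n \<longleftrightarrow> F \<in> carrier_mat n n \<and> (\<forall>i<n. \<forall>j<n. F $$ (i, j) \<in> dual_carrier V) \<and>
    completely_positive V (matrix_space n) (\<lambda>s. map_mat (\<lambda>f. f s) F)"
  by (auto simp: dual_space_def elements_mat_subset_iff)

section \<open>Completely positive maps given by positive matrices\<close>

lemma sum_swap_pairs:
  "(\<Sum>i\<in>I. \<Sum>j\<in>J. \<Sum>a\<in>A. \<Sum>b\<in>B. f i j a b) = (\<Sum>a\<in>A. \<Sum>b\<in>B. \<Sum>i\<in>I. \<Sum>j\<in>J. f i j a b :: 'a::comm_monoid_add)"
proof -
  have "(\<Sum>i\<in>I. \<Sum>j\<in>J. \<Sum>a\<in>A. \<Sum>b\<in>B. f i j a b) = (\<Sum>i\<in>I. \<Sum>a\<in>A. \<Sum>b\<in>B. \<Sum>j\<in>J. f i j a b)"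
    by (rule sum.cong[OF refl]) (subst sum.swap, intro sum.cong refl sum.swap)
  also have "\<dots> = (\<Sum>a\<in>A. \<Sum>b\<in>B. \<Sum>i\<in>I. \<Sum>j\<in>J. f i j a b)"
    by (subst sum.swap) (intro sum.cong refl sum.swap)
  finally show ?thesis .
qed

text \<open>The scalars \<open>F $$ (i, j)\<close> applied to \<open>P $$ (a, b)\<close> form a
  block matrix that can be read in two orders. Positivity of \<open>F\<close> means that s \<mapsto>
  [F_ij(s)] is completely positive, so applying it to \<open>P\<close> gives a positive block
  matrix; exchanging the two pairs of indices keeps the form.\<close>

lemma completely_positive_evaluation:
  assumes P: "P \<in> op_cone S k"
  shows "completely_positive (dual_space (op_space S)) (matrix_space k) (\<lambda>f. map_mat f P)"
  unfolding completely_positive_def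
proof (intro conjI allI ballI)
  show "mo_linear (dual_space (op_space S)) (matrix_space k) (\<lambda>f. map_mat f P)"
    using op_coneD(1)[OF P] by (auto simp: mo_linear_def dual_space_simps matrix_space_simps intro!: eq_matI)
  fix r F
  assume F: "F \<in> mcone (dual_space (op_space S)) r"
  let ?G = "map_mat (\<lambda>s. map_mat (\<lambda>f. f s) F) P"
  have G: "?G \<in> mcone (matrix_space r) k"
    using F P by (simp add: dual_cone_iff completely_positive_def op_space_simps)
  show "map_mat (\<lambda>f. map_mat f P) F \<in> mcone (matrix_space k) r"
    unfolding matrix_cone_iff
  proof (intro conjI allI impI)
    fix w :: "nat \<Rightarrow> nat \<Rightarrow> complex"
    have "(\<Sum>i<r. \<Sum>j<r. \<Sum>a<k. \<Sum>b<k. map_mat (\<lambda>f. map_mat f P) F $$ (i, j) $$ (a, b) * w j b * cnj (w i a)) =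
        (\<Sum>i<r. \<Sum>j<r. \<Sum>a<k. \<Sum>b<k. ?G $$ (a, b) $$ (i, j) * w j b * cnj (w i a))"
      using F op_coneD(1)[OF P] by (intro sum.cong refl) (auto simp: dual_cone_iff)
    also have "\<dots> = (\<Sum>a<k. \<Sum>b<k. \<Sum>i<r. \<Sum>j<r. ?G $$ (a, b) $$ (i, j) * w j b * cnj (w i a))"
      by (rule sum_swap_pairs)
    finally show "0 \<le> (\<Sum>i<r. \<Sum>j<r. \<Sum>a<k. \<Sum>b<k.
        map_mat (\<lambda>f. map_mat f P) F $$ (i, j) $$ (a, b) * w j b * cnj (w i a))"
      using conjunct2[OF conjunct2[OF G[unfolded matrix_cone_iff]], rule_format, of "\<lambda>b j. w j b"] by simp
  qed (use F op_coneD(1)[OF P] in \<open>auto simp: dual_cone_iff\<close>)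
qed

text \<open>One direction of Choi's theorem. Viewed as a scalar kernel on pairs (block, entry),
  \<open>X\<close> has a Gram factorization, and each of its rank-one terms turns the form of the
  image of \<open>X\<close> into the form of \<open>Q\<close> at a new family of vectors.\<close>

lemma completely_positive_schur:
  fixes T :: "('k::chilbert_space \<Rightarrow>\<^sub>L 'k) set"
  assumes T: "operator_system T" and Q: "Q \<in> op_cone T k"
  shows "completely_positive (matrix_space k) (op_space T) (\<lambda>M. \<Sum>a<k. \<Sum>b<k. M $$ (a, b) *\<^sub>C Q $$ (a, b))"
    (is "completely_positive _ _ ?\<psi>")
  unfolding completely_positive_def
proof (intro conjI allI ballI)
  have mem: "?\<psi> M \<in> T" for M
    using op_coneD(2)[OF Q] operator_systemD(1)[OF T]
    by (intro complex_vector.subspace_sum complex_vector.subspace_scale) auto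
  then show "mo_linear (matrix_space k) (op_space T) ?\<psi>"
    by (auto simp: mo_linear_def op_space_simps matrix_space_simps scaleC_add_left sum.distrib
        scaleC_scaleC complex_vector.scale_sum_right intro!: sum.cong)
  fix r X
  assume X: "X \<in> mcone (matrix_space k) r"
  note X' = X[unfolded matrix_cone_iff]
  show "map_mat ?\<psi> X \<in> mcone (op_space T) r"
    unfolding op_space_simps op_cone_iff
  proof (intro conjI allI impI)
    fix v :: "nat \<Rightarrow> 'k"
    define K where "K p q = X $$ (fst p, fst q) $$ (snd p, snd q)" for p q
    let ?I = "{..<r} \<times> {..<k}"
    have "0 \<le> (\<Sum>p\<in>?I. \<Sum>q\<in>?I. cnj (z p) * K p q * z q)" for z
    proof -
      have "(\<Sum>p\<in>?I. \<Sum>q\<in>?I. cnj (z p) * K p q * z q) =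
          (\<Sum>i<r. \<Sum>a<k. \<Sum>j<r. \<Sum>b<k. X $$ (i, j) $$ (a, b) * z (j, b) * cnj (z (i, a)))"
        by (simp add: sum.cartesian_product' K_def mult_ac)
      also have "\<dots> = (\<Sum>i<r. \<Sum>j<r. \<Sum>a<k. \<Sum>b<k. X $$ (i, j) $$ (a, b) * z (j, b) * cnj (z (i, a)))"
        by (intro sum.cong refl sum.swap)
      finally show ?thesis using X' by simp
    qed
    then obtain c where c: "\<And>p q. p \<in> ?I \<Longrightarrow> q \<in> ?I \<Longrightarrow> K p q = (\<Sum>l\<in>?I. c l p * cnj (c l q))"
      using psd_kernel_factorization[of ?I K] by auto
    \<comment> \<open>The vectors belonging to the rank-one term \<open>l\<close>: the sums over the
      block indices \<open>i\<close> and \<open>j\<close> collapse into them.\<close>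
    define w where "w l b = (\<Sum>j<r. cnj (c l (j, b)) *\<^sub>C v j)" for l b
    have "X \<in> carrier_mat r r" using X' by simp
    then have "(\<Sum>i<r. \<Sum>j<r. cinner (v i) (blinfun_apply (map_mat ?\<psi> X $$ (i, j)) (v j))) =
        (\<Sum>i<r. \<Sum>j<r. \<Sum>a<k. \<Sum>b<k. K (i, a) (j, b) * cinner (v i) (blinfun_apply (Q $$ (a, b)) (v j)))"
      by (intro sum.cong refl)
        (simp add: blinfun.sum_left blinfun_apply_scaleC cinner_sum_right cinner_scaleC_right K_def)
    also have "\<dots> = (\<Sum>a<k. \<Sum>b<k. \<Sum>i<r. \<Sum>j<r. K (i, a) (j, b) * cinner (v i) (blinfun_apply (Q $$ (a, b)) (v j)))"
      by (rule sum_swap_pairs)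
    also have "\<dots> = (\<Sum>a<k. \<Sum>b<k. \<Sum>i<r. \<Sum>j<r. \<Sum>l\<in>?I.
        c l (i, a) * cnj (c l (j, b)) * cinner (v i) (blinfun_apply (Q $$ (a, b)) (v j)))"
      by (intro sum.cong refl) (simp add: c sum_distrib_right)
    also have "\<dots> = (\<Sum>a<k. \<Sum>b<k. \<Sum>l\<in>?I. \<Sum>i<r. \<Sum>j<r.
        c l (i, a) * cnj (c l (j, b)) * cinner (v i) (blinfun_apply (Q $$ (a, b)) (v j)))"
    proof (intro sum.cong refl)
      fix a b
      show "(\<Sum>i<r. \<Sum>j<r. \<Sum>l\<in>?I. c l (i, a) * cnj (c l (j, b)) * cinner (v i) (blinfun_apply (Q $$ (a, b)) (v j))) =
        (\<Sum>l\<in>?I. \<Sum>i<r. \<Sum>j<r. c l (i, a) * cnj (c l (j, b)) * cinner (v i) (blinfun_apply (Q $$ (a, b)) (v j)))"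
        by (subst sum.swap[of _ ?I]) (intro sum.cong refl sum.swap)
    qed
    also have "\<dots> = (\<Sum>a<k. \<Sum>b<k. \<Sum>l\<in>?I. cinner (w l a) (blinfun_apply (Q $$ (a, b)) (w l b)))"
      using op_coneD(2)[OF Q] operator_systemD(2)[OF T]
      by (intro sum.cong refl) (simp add: w_def cinner_weighted_sums)
    also have "\<dots> = (\<Sum>l\<in>?I. \<Sum>a<k. \<Sum>b<k. cinner (w l a) (blinfun_apply (Q $$ (a, b)) (w l b)))"
      by (subst sum.swap[of _ ?I]) (intro sum.cong refl sum.swap)
    also have "0 \<le> \<dots>"
      by (intro sum_nonneg op_coneD(3)[OF Q])
    finally show "0 \<le> (\<Sum>i<r. \<Sum>j<r. cinner (v i) (blinfun_apply (map_mat ?\<psi> X $$ (i, j)) (v j)))" .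
  qed (use X' mem in auto)
qed

section \<open>Choi matrices of maps on M_n\<close>

definition matrix_unit :: "nat \<Rightarrow> nat \<Rightarrow> nat \<Rightarrow> complex mat" where
  "matrix_unit n a b = mat n n (\<lambda>(i, j). if i = a \<and> j = b then 1 else 0)"

text \<open>The block matrix \<open>?E\<close> of all matrix units is positive, as its form at
  \<open>w\<close> is the squared modulus of the sum of the \<open>w j j\<close>. Complete
  positivity at level \<open>n\<close> carries this over to the images.\<close>

lemma choi_matrix_positive:
  assumes "completely_positive (matrix_space n) (op_space T) \<psi>"
  shows "mat n n (\<lambda>(a, b). \<psi> (matrix_unit n a b)) \<in> op_cone T n"
proof -
  let ?E = "mat n n (\<lambda>(a, b). matrix_unit n a b)"
  have "?E \<in> mcone (matrix_space n) n"
    unfolding matrix_cone_iff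
  proof (intro conjI allI impI)
    fix w :: "nat \<Rightarrow> nat \<Rightarrow> complex"
    have "(\<Sum>i<n. \<Sum>j<n. \<Sum>a<n. \<Sum>b<n. ?E $$ (i, j) $$ (a, b) * w j b * cnj (w i a)) =
        (\<Sum>i<n. \<Sum>j<n. \<Sum>a<n. \<Sum>b<n. if a = i then if b = j then w j j * cnj (w i i) else 0 else 0)"
      by (intro sum.cong refl) (simp add: matrix_unit_def)
    also have "\<dots> = (\<Sum>i<n. \<Sum>j<n. \<Sum>a<n. if a = i then w j j * cnj (w i i) else 0)"
      by (intro sum.cong refl) auto
    also have "\<dots> = (\<Sum>j<n. w j j) * cnj (\<Sum>i<n. w i i)"
      by (subst sum.swap) (simp add: sum_product)
    also have "\<dots> = of_real ((cmod (\<Sum>j<n. w j j))\<^sup>2)"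
      by (rule complex_norm_square[symmetric])
    also have "0 \<le> \<dots>" by (simp add: less_eq_complex_def)
    finally show "0 \<le> (\<Sum>i<n. \<Sum>j<n. \<Sum>a<n. \<Sum>b<n. ?E $$ (i, j) $$ (a, b) * w j b * cnj (w i a))" .
  qed (auto simp: matrix_unit_def)
  then have "map_mat \<psi> ?E \<in> op_cone T n"
    using assms by (simp add: completely_positive_def op_space_simps)
  also have "map_mat \<psi> ?E = mat n n (\<lambda>(a, b). \<psi> (matrix_unit n a b))"
    by (intro eq_matI) auto
  finally show ?thesis .
qed

lemma mo_linear_matrix_expansion:
  assumes lin: "mo_linear (matrix_space n) (op_space T) \<psi>" and M: "M \<in> carrier_mat n n"
  shows "\<psi> M = (\<Sum>a<n. \<Sum>b<n. M $$ (a, b) *\<^sub>C \<psi> (matrix_unit n a b))"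
proof -
  \<comment> \<open>Keeps the entries of \<open>M\<close> at the positions in \<open>I\<close>.
    Adding positions one at a time uses only binary additivity on the carrier, and the empty case is
    \<open>0 \<cdot>\<^sub>m M\<close>.\<close>
  define R where "R I = mat n n (\<lambda>p. if p \<in> I then M $$ p else 0)" for I
  have add: "\<psi> (X + Y) = \<psi> X + \<psi> Y" if "X \<in> carrier_mat n n" "Y \<in> carrier_mat n n" for X Y
    using lin that by (simp add: mo_linear_def matrix_space_simps op_space_simps)
  have scale: "\<psi> (c \<cdot>\<^sub>m X) = c *\<^sub>C \<psi> X" if "X \<in> carrier_mat n n" for c X
    using lin that by (simp add: mo_linear_def matrix_space_simps op_space_simps)
  have "\<psi> (R I) = (\<Sum>p\<in>I. M $$ p *\<^sub>C \<psi> (matrix_unit n (fst p) (snd p)))"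
    if "finite I" "I \<subseteq> {..<n} \<times> {..<n}" for I
    using that
  proof (induction I)
    case empty
    have "R {} = 0 \<cdot>\<^sub>m M" using M by (intro eq_matI) (auto simp: R_def)
    then show ?case using scale[OF M, of 0] by simp
  next
    case (insert p I)
    then have "R (insert p I) = M $$ p \<cdot>\<^sub>m matrix_unit n (fst p) (snd p) + R I"
      by (intro eq_matI) (auto simp: R_def matrix_unit_def)
    then show ?case
      using insert by (simp add: add scale R_def matrix_unit_def)
  qed
  from this[of "{..<n} \<times> {..<n}"] have "\<psi> (R ({..<n} \<times> {..<n})) =
      (\<Sum>a<n. \<Sum>b<n. M $$ (a, b) *\<^sub>C \<psi> (matrix_unit n a b))"
    by (simp add: sum.cartesian_product')
  moreover have "R ({..<n} \<times> {..<n}) = M" using M by (intro eq_matI) (auto simp: R_def)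
  ultimately show ?thesis by simp
qed


section \<open>Biduality\<close>

text \<open>Every element of \<open>S\<close> is a combination of two self-adjoint ones, so a
  maximal independent set of self-adjoint elements is a basis. Conjugating the coordinates of
  \<open>x\<close> expands its adjoint in the same basis, whence the last property.\<close>

lemma hermitian_coordinates:
  assumes S: "operator_system S" and fin: "finite_dimensional S"
  obtains B g where "finite B" "B \<subseteq> S" "\<And>b. b \<in> B \<Longrightarrow> is_adjoint b b"
    "\<And>b. b \<in> B \<Longrightarrow> g b \<in> dual_carrier (op_space S)"
    "\<And>x. x \<in> S \<Longrightarrow> x = (\<Sum>b\<in>B. g b x *\<^sub>C b)"
    "\<And>x y b. x \<in> S \<Longrightarrow> y \<in> S \<Longrightarrow> is_adjoint x y \<Longrightarrow> b \<in> B \<Longrightarrow> g b y = cnj (g b x)"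
proof -
  note sub = operator_systemD(1)[OF S]
  define H where "H = {x \<in> S. is_adjoint x x}"
  obtain B where B: "B \<subseteq> H" "complex_vector.independent B" "H \<subseteq> cspan B"
    using complex_vector.maximal_independent_subset[of H] by blast
  have BS: "B \<subseteq> S" using B(1) by (auto simp: H_def)
  have spanB: "cspan B = S"
  proof
    show "cspan B \<subseteq> S" using BS sub by (simp add: complex_vector.span_minimal)
    show "S \<subseteq> cspan B"
    proof
      fix x assume x: "x \<in> S"
      then obtain y where y: "y \<in> S" "is_adjoint x y"
        using operator_systemD(4)[OF S] by blast
      have sum: "x + y \<in> H"
        using x y sub is_adjoint_add[OF y(2) is_adjoint_sym[OF y(2)]]
        by (simp add: H_def complex_vector.subspace_add add.commute)
      have diff: "\<i> *\<^sub>C (x - y) \<in> H"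
      proof -
        have "is_adjoint (\<i> *\<^sub>C (x - y)) (cnj \<i> *\<^sub>C (y - x))"
          by (intro is_adjoint_scaleC is_adjoint_diff y is_adjoint_sym[OF y(2)])
        also have "cnj \<i> *\<^sub>C (y - x) = \<i> *\<^sub>C (x - y)"
          by (metis complex_cnj_i complex_vector.scale_minus_left complex_vector.scale_minus_right minus_diff_eq)
        finally show ?thesis
          using x y sub by (simp add: H_def complex_vector.subspace_scale complex_vector.subspace_diff)
      qed
      \<comment> \<open>The Cartesian decomposition into real and imaginary part, written with the
        self-adjoint elements \<open>x + y\<close> and
        \<open>\<i> *\<^sub>C (x - y)\<close>.\<close>
      have "x = (1 / 2) *\<^sub>C (x + y) + (- \<i> / 2) *\<^sub>C \<i> *\<^sub>C (x - y)"
      proof -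
        have "(1 / 2) *\<^sub>C (x + y) + (- \<i> / 2) *\<^sub>C \<i> *\<^sub>C (x - y) = (1 / 2) *\<^sub>C ((x + y) + (x - y))"
          by (simp add: scaleC_scaleC scaleC_add_right complex_vector.scale_right_diff_distrib)
        also have "(x + y) + (x - y) = 2 *\<^sub>C x"
          using scaleC_add_left[of 1 1 x] by (simp add: scaleC_one)
        finally show ?thesis by (simp add: scaleC_scaleC scaleC_one)
      qed
      also have "\<dots> \<in> cspan B"
        by (intro complex_vector.span_add complex_vector.span_scale subsetD[OF B(3)] sum diff)
      finally show "x \<in> cspan B" .
    qed
  qed
  have finB: "finite B"
    using fin B(2) BS complex_vector.independent_span_bound[of _ B] unfolding finite_dimensional_def by blast
  \<comment> \<open>\<open>representation\<close> is 0 outside the span, so \<open>g b\<close>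
    vanishes off \<open>S\<close> as membership in \<open>dual_carrier\<close> demands.\<close>
  define g where "g b x = complex_vector.representation B x b" for b x
  have expand: "x = (\<Sum>b\<in>B. g b x *\<^sub>C b)" if "x \<in> S" for x
    using complex_vector.sum_representation_eq[of B x B] B(2) finB spanB that by (simp add: g_def)
  have g_add: "g b (x + y) = g b x + g b y" if "x \<in> S" "y \<in> S" for b x y
    using that B(2) spanB by (simp add: g_def complex_vector.representation_add)
  have g_scale: "g b (c *\<^sub>C x) = c * g b x" if "x \<in> S" for b c x
    using that B(2) spanB by (simp add: g_def complex_vector.representation_scale)
  have g_dual: "g b \<in> dual_carrier (op_space S)" for b
    unfolding dual_carrier_op_space using g_add g_scale spanB
    by (auto simp: g_def complex_vector.representation_def)
  have g_adj: "g b y = cnj (g b x)" if "x \<in> S" "y \<in> S" "is_adjoint x y" "b \<in> B" for b x y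
  proof -
    have "is_adjoint x (\<Sum>b\<in>B. cnj (g b x) *\<^sub>C b)"
      by (subst expand[OF \<open>x \<in> S\<close>], intro is_adjoint_sum is_adjoint_scaleC) (use B(1) in \<open>auto simp: H_def\<close>)
    then have "(\<Sum>b\<in>B. (g b y - cnj (g b x)) *\<^sub>C b) = 0"
      using is_adjoint_unique[OF \<open>is_adjoint x y\<close>] expand[OF \<open>y \<in> S\<close>]
      by (simp add: complex_vector.scale_left_diff_distrib sum_subtractf)
    then show ?thesis
      using complex_vector.independentD[OF B(2) finB subset_refl] \<open>b \<in> B\<close> by fastforce
  qed
  show ?thesis
    by (rule that[of B g]) (use finB BS B(1) g_dual expand g_adj in \<open>auto simp: H_def\<close>)
qed

lemma dual_carrier_sum:
  assumes "csubspace S" "f \<in> dual_carrier (op_space S)" "\<And>b. b \<in> B \<Longrightarrow> x b \<in> S"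
  shows "f (\<Sum>b\<in>B. c b *\<^sub>C x b) = (\<Sum>b\<in>B. c b * f (x b))"
proof -
  have "f 0 = 0"
    using assms(2) complex_vector.subspace_0[OF assms(1)] unfolding dual_carrier_op_space
    by (metis complex_vector.scale_zero_left mult_zero_left)
  then show ?thesis
    using assms(3)
  proof (induction B rule: infinite_finite_induct)
    case (insert b B)
    have "(\<Sum>b\<in>B. c b *\<^sub>C x b) \<in> S"
      using assms(1) insert.prems(2) by (auto intro!: complex_vector.subspace_sum complex_vector.subspace_scale)
    then show ?case
      using insert assms(1,2) by (simp add: dual_carrier_op_space complex_vector.subspace_scale)
  qed simp_all
qed

lemma mo_linear_dual_sum:
  assumes lin: "mo_linear (dual_space V) (matrix_space n) \<phi>"
    and g: "\<And>b. b \<in> B \<Longrightarrow> g b \<in> dual_carrier V" and "finite B" and ij: "i < n" "j < n"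
  shows "\<phi> (\<lambda>x. \<Sum>b\<in>B. c b * g b x) $$ (i, j) = (\<Sum>b\<in>B. c b * \<phi> (g b) $$ (i, j))"
proof -
  have \<phi>: "\<phi> f \<in> carrier_mat n n" "\<phi> (\<lambda>x. f x + f' x) = \<phi> f + \<phi> f'" "\<phi> (\<lambda>x. c * f x) = c \<cdot>\<^sub>m \<phi> f"
    if "f \<in> dual_carrier V" "f' \<in> dual_carrier V" for f f' c
    using lin that unfolding mo_linear_def dual_space_simps matrix_space_simps by blast+
  have scale: "(\<lambda>x. c * f x) \<in> dual_carrier V" if "f \<in> dual_carrier V" for c f
    using that by (auto simp: dual_carrier_def algebra_simps)
  have add: "(\<lambda>x. f x + f' x) \<in> dual_carrier V" if "f \<in> dual_carrier V" "f' \<in> dual_carrier V" for f f'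
    using that by (auto simp: dual_carrier_def algebra_simps)
  \<comment> \<open>Membership is carried through the induction because \<open>\<phi>\<close> is
    additive only on the carrier.\<close>
  have "(\<lambda>x. \<Sum>b\<in>B. c b * g b x) \<in> dual_carrier V \<and>
      \<phi> (\<lambda>x. \<Sum>b\<in>B. c b * g b x) $$ (i, j) = (\<Sum>b\<in>B. c b * \<phi> (g b) $$ (i, j))"
    using \<open>finite B\<close> g
  proof (induction B)
    case empty
    have z: "(\<lambda>x. 0) \<in> dual_carrier V" by (simp add: dual_carrier_def)
    then show ?case
      using arg_cong[OF \<phi>(3)[OF z z, of 0], of "\<lambda>M. M $$ (i, j)"] \<phi>(1)[OF z z] ij by simp
  next
    case (insert b B)
    then have mem: "g b \<in> dual_carrier V" "(\<lambda>x. c b * g b x) \<in> dual_carrier V" "(\<lambda>x. \<Sum>b\<in>B. c b * g b x) \<in> dual_carrier V"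
      by (simp_all add: scale)
    have "\<phi> (\<lambda>x. c b * g b x + (\<Sum>b\<in>B. c b * g b x)) = c b \<cdot>\<^sub>m \<phi> (g b) + \<phi> (\<lambda>x. \<Sum>b\<in>B. c b * g b x)"
      using \<phi>(2)[OF mem(2,3)] \<phi>(3)[OF mem(1,1)] by simp
    then show ?case
      using insert add[OF mem(2,3)] \<phi>(1)[OF mem(1,1)] \<phi>(1)[OF mem(3,3)] ij by simp
  qed
  then show ?thesis ..
qed

text \<open>Applying \<open>\<phi>\<close> to the matrix of vector functionals \<open>s \<mapsto> \<langle>v\<^sub>i, s v\<^sub>j\<rangle>\<close> already detects positivity of \<open>P\<close>,
  so no Hahn--Banach argument is needed.\<close>

lemma completely_positive_dual_matrix:
  fixes S :: "('h::chilbert_space \<Rightarrow>\<^sub>L 'h) set"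
  assumes S: "operator_system S" and fin: "finite_dimensional S"
    and cp: "completely_positive (dual_space (op_space S)) (matrix_space n) \<phi>"
  shows "\<exists>P\<in>op_cone S n. \<forall>f\<in>dual_carrier (op_space S). \<phi> f = map_mat f P"
proof -
  obtain B g where B: "finite B" "B \<subseteq> S" "\<And>b. b \<in> B \<Longrightarrow> is_adjoint b b"
    and g: "\<And>b. b \<in> B \<Longrightarrow> g b \<in> dual_carrier (op_space S)"
    and expand: "\<And>x. x \<in> S \<Longrightarrow> x = (\<Sum>b\<in>B. g b x *\<^sub>C b)"
    and g_adj: "\<And>x y b. x \<in> S \<Longrightarrow> y \<in> S \<Longrightarrow> is_adjoint x y \<Longrightarrow> b \<in> B \<Longrightarrow> g b y = cnj (g b x)"
    by (rule hermitian_coordinates[OF S fin]) (rule that, assumption+)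
  note sub = operator_systemD(1)[OF S]
  have lin: "mo_linear (dual_space (op_space S)) (matrix_space n) \<phi>"
    using cp by (simp add: completely_positive_def)
  \<comment> \<open>Forced by the claim: applying \<open>g b\<close> to the entries of
    \<open>P\<close> must give \<open>\<phi> (g b)\<close>, so these values are the coordinates of
    the entries.\<close>
  define P where "P = mat n n (\<lambda>(i, j). \<Sum>b\<in>B. \<phi> (g b) $$ (i, j) *\<^sub>C b)"
  have P_in: "P $$ (i, j) \<in> S" if "i < n" "j < n" for i j
    using that B sub by (auto simp: P_def intro!: complex_vector.subspace_sum complex_vector.subspace_scale)
  have eval: "\<phi> f = map_mat f P" if f: "f \<in> dual_carrier (op_space S)" for f
  proof (rule eq_matI)
    have fc: "\<phi> f \<in> carrier_mat n n"
      using lin f by (simp add: mo_linear_def dual_space_simps matrix_space_simps)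
    then show "dim_row (\<phi> f) = dim_row (map_mat f P)" "dim_col (\<phi> f) = dim_col (map_mat f P)"
      by (auto simp: P_def)
    have "f = (\<lambda>x. \<Sum>b\<in>B. f b * g b x)"
    proof
      fix x
      show "f x = (\<Sum>b\<in>B. f b * g b x)"
      proof (cases "x \<in> S")
        case True
        have "f x = f (\<Sum>b\<in>B. g b x *\<^sub>C b)" using expand[OF True] by simp
        also have "\<dots> = (\<Sum>b\<in>B. g b x * f b)" using B by (intro dual_carrier_sum[OF sub f]) auto
        finally show ?thesis by (simp add: mult.commute)
      qed (use f g in \<open>auto simp: dual_carrier_op_space intro!: sum.neutral\<close>)
    qed
    then have "\<phi> f = \<phi> (\<lambda>x. \<Sum>b\<in>B. f b * g b x)" by simp
    moreover fix i j assume "i < dim_row (map_mat f P)" "j < dim_col (map_mat f P)"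
    ultimately show "\<phi> f $$ (i, j) = map_mat f P $$ (i, j)"
      using mo_linear_dual_sum[OF lin g B(1), where c = f and i = i and j = j] B dual_carrier_sum[OF sub f, of B "\<lambda>b. b"]
      by (auto simp: P_def mult.commute subset_iff)
  qed
  have "P \<in> op_cone S n"
    unfolding op_cone_iff
  proof (intro conjI allI impI)
    fix v :: "nat \<Rightarrow> 'h"
    \<comment> \<open>The vector functionals are cut off outside \<open>S\<close> to be elements of
      the dual carrier.\<close>
    define F where "F = mat n n (\<lambda>(i, j) x. if x \<in> S then cinner (v i) (blinfun_apply x (v j)) else 0)"
    have Fd: "F $$ (i, j) \<in> dual_carrier (op_space S)" if "i < n" "j < n" for i j
      using that sub by (auto simp: F_def dual_carrier_op_space blinfun.add_left cinner_add_right
          blinfun_apply_scaleC cinner_scaleC_right complex_vector.subspace_add complex_vector.subspace_scale)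
    have "F \<in> mcone (dual_space (op_space S)) n"
      unfolding dual_cone_iff completely_positive_def
    proof (intro conjI allI impI ballI)
      show "mo_linear (op_space S) (matrix_space n) (\<lambda>s. map_mat (\<lambda>f. f s) F)"
        using Fd by (auto simp: mo_linear_def op_space_simps matrix_space_simps dual_carrier_op_space F_def intro!: eq_matI)
      fix k X assume "X \<in> mcone (op_space S) k"
      then have X: "X \<in> op_cone S k" by (simp add: op_space_simps)
      show "map_mat (\<lambda>s. map_mat (\<lambda>f. f s) F) X \<in> mcone (matrix_space n) k"
        unfolding matrix_cone_iff
      proof (intro conjI allI impI)
        fix w :: "nat \<Rightarrow> nat \<Rightarrow> complex"
        \<comment> \<open>The double conjugation matches the shape of
          \<open>cinner_weighted_sums\<close>.\<close>
        define y where "y b = (\<Sum>j<n. cnj (cnj (w b j)) *\<^sub>C v j)" for b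
        have "(\<Sum>a<k. \<Sum>b<k. \<Sum>i<n. \<Sum>j<n.
            map_mat (\<lambda>s. map_mat (\<lambda>f. f s) F) X $$ (a, b) $$ (i, j) * w b j * cnj (w a i)) =
            (\<Sum>a<k. \<Sum>b<k. \<Sum>i<n. \<Sum>j<n. cnj (w a i) * cnj (cnj (w b j)) * cinner (v i) (blinfun_apply (X $$ (a, b)) (v j)))"
          using op_coneD(1,2)[OF X] by (intro sum.cong refl) (simp add: F_def mult_ac)
        also have "\<dots> = (\<Sum>a<k. \<Sum>b<k. cinner (y a) (blinfun_apply (X $$ (a, b)) (y b)))"
          unfolding y_def using op_coneD(2)[OF X] operator_systemD(2)[OF S]
          by (intro sum.cong refl) (rule cinner_weighted_sums[symmetric], auto)
        finally show "0 \<le> (\<Sum>a<k. \<Sum>b<k. \<Sum>i<n. \<Sum>j<n.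
            map_mat (\<lambda>s. map_mat (\<lambda>f. f s) F) X $$ (a, b) $$ (i, j) * w b j * cnj (w a i))"
          using op_coneD(3)[OF X] by simp
      qed (use op_coneD(1)[OF X] in \<open>auto simp: F_def\<close>)
    qed (use Fd in \<open>auto simp: F_def\<close>)
    then have "map_mat \<phi> F \<in> mcone (matrix_space n) n"
      using cp by (simp add: completely_positive_def)
    \<comment> \<open>Testing at \<Sum> e_i \<otimes> e_i keeps only entry \<open>(i, j)\<close> of
      block \<open>(i, j)\<close>. By \<open>eval\<close> that entry is the functional
      \<open>F $$ (i, j)\<close> at \<open>P $$ (i, j)\<close>, so the sum is the form of
      \<open>P\<close> at \<open>v\<close>.\<close>
    then have "0 \<le> (\<Sum>i<n. \<Sum>j<n. \<Sum>a<n. \<Sum>b<n. map_mat \<phi> F $$ (i, j) $$ (a, b) *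
        (if b = j then 1 else 0) * cnj (if a = i then 1 else 0))"
      unfolding matrix_cone_iff by (elim conjE) (erule allE[of _ "\<lambda>i a. if a = i then 1 else 0"])
    also have "\<dots> = (\<Sum>i<n. \<Sum>j<n. \<Sum>a<n. \<Sum>b<n.
        if a = i then if b = j then cinner (v i) (blinfun_apply (P $$ (i, j)) (v j)) else 0 else 0)"
    proof (intro sum.cong refl)
      fix i j a b assume "i \<in> {..<n}" "j \<in> {..<n}" "a \<in> {..<n}" "b \<in> {..<n}"
      moreover from this have "map_mat \<phi> F $$ (i, j) $$ (i, j) = cinner (v i) (blinfun_apply (P $$ (i, j)) (v j))"
        using eval[OF Fd, of i j] P_in[of i j] by (simp add: F_def P_def)
      ultimately show "map_mat \<phi> F $$ (i, j) $$ (a, b) * (if b = j then 1 else 0) * cnj (if a = i then 1 else 0) =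
          (if a = i then if b = j then cinner (v i) (blinfun_apply (P $$ (i, j)) (v j)) else 0 else 0)"
        by simp
    qed
    also have "\<dots> = (\<Sum>i<n. \<Sum>j<n. \<Sum>a<n. if a = i then cinner (v i) (blinfun_apply (P $$ (i, j)) (v j)) else 0)"
      by (intro sum.cong refl) auto
    finally show "0 \<le> (\<Sum>i<n. \<Sum>j<n. cinner (v i) (blinfun_apply (P $$ (i, j)) (v j)))" by simp
  qed (use P_in in \<open>auto simp: P_def\<close>)
  with eval show ?thesis by blast
qed


section \<open>Approximate factorization\<close>

lemma op_cone_list:
  assumes "P \<in> op_cone S k" "Q \<in> op_cone T k"
  defines "qs \<equiv> map (\<lambda>(i, j). (P $$ (i, j), Q $$ (i, j))) (List.product [0..<k] [0..<k])"
  shows "set qs \<subseteq> S \<times> T"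
  using op_coneD(2)[OF assms(1)] op_coneD(2)[OF assms(2)] by (auto simp: qs_def)

text \<open>The Schur sum and the list \<open>?rs\<close>, which is a list for \<open>u\<close> with
  one pair for the shift put in front, represent the same tensor. Applying \<open>f\<close> to the
  first leg therefore gives equal values.\<close>

lemma tensor_map_schur:
  fixes S :: "('h::chilbert_space \<Rightarrow>\<^sub>L 'h) set" and T :: "('k::chilbert_space \<Rightarrow>\<^sub>L 'k) set"
  assumes S: "operator_system S" and T: "operator_system T" and u: "u \<in> tensor_space S T"
    and f: "f \<in> dual_carrier (op_space S)" and P: "P \<in> op_cone S k" and Q: "Q \<in> op_cone T k"
    and eq: "e *\<^sub>R tensor_one + u = (\<Sum>i<k. \<Sum>j<k. P $$ (i, j) \<otimes>\<^sub>t Q $$ (i, j))"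
  shows "(\<Sum>i<k. \<Sum>j<k. f (P $$ (i, j)) *\<^sub>C Q $$ (i, j)) = tensor_map S T u f + e *\<^sub>R (f id_blinfun *\<^sub>C id_blinfun)"
proof -
  note sub = operator_systemD(1)[OF S]
  obtain ps where ps: "set ps \<subseteq> S \<times> T" "u = (\<Sum>(x, y)\<leftarrow>ps. x \<otimes>\<^sub>t y)"
    using tensor_space_list[OF sub u] by blast
  define qs where "qs = map (\<lambda>(i, j). (P $$ (i, j), Q $$ (i, j))) (List.product [0..<k] [0..<k])"
  have qs: "set qs \<subseteq> S \<times> T" unfolding qs_def by (rule op_cone_list[OF P Q])
  let ?rs = "(e *\<^sub>R id_blinfun, id_blinfun) # ps"
  have id: "e *\<^sub>R id_blinfun \<in> S"
    using operator_systemD(3)[OF S] sub by (simp add: scaleR_scaleC complex_vector.subspace_scale)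
  have "(\<Sum>(x, y)\<leftarrow>qs. f x *\<^sub>C y) = (\<Sum>(x, y)\<leftarrow>?rs. f x *\<^sub>C y)"
  proof (rule tensor_map_independent[OF sub _ _ qs])
    show "set ?rs \<subseteq> S \<times> T" using ps(1) id operator_systemD(3)[OF T] by simp
    show "(\<Sum>(x, y)\<leftarrow>qs. x \<otimes>\<^sub>t y) = (\<Sum>(x, y)\<leftarrow>?rs. x \<otimes>\<^sub>t y)"
      using eq unfolding qs_def sum_list_product_upt by (simp add: ps(2) tensor_one_def tensor_pure_scaleR_left)
  qed (use f in \<open>auto simp: dual_carrier_op_space\<close>)
  moreover have "f (e *\<^sub>R id_blinfun) = of_real e * f id_blinfun"
    using f operator_systemD(3)[OF S] by (simp add: dual_carrier_op_space scaleR_scaleC)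
  moreover have "tensor_map S T u f = (\<Sum>(x, y)\<leftarrow>ps. f x *\<^sub>C y)"
    unfolding ps(2) by (rule tensor_map_list[OF sub f ps(1)])
  ultimately show ?thesis
    unfolding qs_def sum_list_product_upt by (simp add: scaleR_scaleC scaleC_scaleC add.commute)
qed

lemma mo_positive_max_tensor_iff:
  fixes S :: "('h::chilbert_space \<Rightarrow>\<^sub>L 'h) set" and T :: "('k::chilbert_space \<Rightarrow>\<^sub>L 'k) set"
  assumes "operator_system T" "u \<in> tensor_space S T"
  shows "mo_positive (max_tensor S T) u \<longleftrightarrow> (\<forall>e>0. e *\<^sub>R tensor_one + u \<in> schur_cone S T)"
proof -
  have "mat 1 1 (\<lambda>(i, j). if i = j then e *\<^sub>R tensor_one else 0) + mat 1 1 (\<lambda>_. u) =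
      mat 1 1 (\<lambda>_. e *\<^sub>R tensor_one + u)" for e :: real
    by (intro eq_matI) auto
  moreover have "elements_mat (mat 1 1 (\<lambda>_. u)) \<subseteq> tensor_space S T"
    using assms(2) by (subst elements_mat_subset_iff) auto
  ultimately show ?thesis
    using assms by (simp add: mo_positive_def max_tensor_def max_dcone_1_iff[OF assms(1), unfolded One_nat_def])
qed

text \<open>Turns a sequence into a net over an arbitrary infinite index type: the range of an
  injection \<open>r\<close> from the naturals is ordered by preimages, so its tails correspond to
  tails of the sequence.\<close>

lemma tendsto_net_filter_range:
  assumes "inj r" and lim: "(\<lambda>m. X (r m)) \<longlonglongrightarrow> L"
  shows "(X \<longlongrightarrow> L) (net_filter (range r) (\<lambda>i j. inv_into UNIV r i \<le> (inv_into UNIV r j :: nat)))"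
    and "directed_set (range r) (\<lambda>i j. inv_into UNIV r i \<le> (inv_into UNIV r j :: nat))"
proof -
  show dir: "directed_set (range r) (\<lambda>i j. inv_into UNIV r i \<le> (inv_into UNIV r j :: nat))"
    unfolding directed_set_def
  proof (intro conjI ballI impI)
    fix a b assume "a \<in> range r" "b \<in> range r"
    show "\<exists>c\<in>range r. inv_into UNIV r a \<le> inv_into UNIV r c \<and> inv_into UNIV r b \<le> inv_into UNIV r c"
      by (rule bexI[of _ "r (max (inv_into UNIV r a) (inv_into UNIV r b))"]) (use \<open>inj r\<close> in auto)
  qed auto
  show "(X \<longlongrightarrow> L) (net_filter (range r) (\<lambda>i j. inv_into UNIV r i \<le> inv_into UNIV r j))"
    using lim \<open>inj r\<close> unfolding tendsto_def eventually_net_filter[OF dir] eventually_sequentially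
    by (auto simp: image_iff)
qed

text \<open>The shifted tensor factors exactly, through evaluation at \<open>P\<close> followed by
  the Schur map of \<open>Q\<close>. The shift by \<open>e\<close> is the only error relative to the
  map of \<open>u\<close>.\<close>

lemma schur_cone_factorization:
  fixes S :: "('h::chilbert_space \<Rightarrow>\<^sub>L 'h) set" and T :: "('k::chilbert_space \<Rightarrow>\<^sub>L 'k) set"
  assumes S: "operator_system S" and T: "operator_system T" and u: "u \<in> tensor_space S T"
    and pos: "e *\<^sub>R tensor_one + u \<in> schur_cone S T"
  shows "\<exists>n \<phi> \<psi>. 0 < n \<and>
      completely_positive (dual_space (op_space S)) (matrix_space n) \<phi> \<and>
      completely_positive (matrix_space n) (op_space T) \<psi> \<and>
      (\<forall>f \<in> dual_carrier (op_space S). \<psi> (\<phi> f) = tensor_map S T u f + e *\<^sub>R (f id_blinfun *\<^sub>C id_blinfun))"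
proof -
  obtain k P Q where eq: "e *\<^sub>R tensor_one + u = (\<Sum>i<k. \<Sum>j<k. P $$ (i, j) \<otimes>\<^sub>t Q $$ (i, j))"
    and k: "0 < k" and P: "P \<in> op_cone S k" and Q: "Q \<in> op_cone T k"
    using pos unfolding schur_cone_def by blast
  let ?\<psi> = "\<lambda>M. \<Sum>a<k. \<Sum>b<k. M $$ (a, b) *\<^sub>C Q $$ (a, b)"
  have "?\<psi> (map_mat f P) = tensor_map S T u f + e *\<^sub>R (f id_blinfun *\<^sub>C id_blinfun)"
    if "f \<in> dual_carrier (op_space S)" for f
    using tensor_map_schur[OF S T u that P Q eq] op_coneD(1)[OF P] by simp
  then show ?thesis
    using k completely_positive_evaluation[OF P] completely_positive_schur[OF T Q] by blast
qed

lemma positive_approximate_factorization: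
  fixes S :: "('h::chilbert_space \<Rightarrow>\<^sub>L 'h) set" and T :: "('k::chilbert_space \<Rightarrow>\<^sub>L 'k) set"
  assumes S: "operator_system S" and T: "operator_system T" and u: "u \<in> tensor_space S T"
    and pos: "\<And>e. e > 0 \<Longrightarrow> e *\<^sub>R tensor_one + u \<in> schur_cone S T"
  shows "\<exists>(n :: nat \<Rightarrow> nat) \<phi> \<psi>.
      (\<forall>l. 0 < n l \<and>
        completely_positive (dual_space (op_space S)) (matrix_space (n l)) (\<phi> l) \<and>
        completely_positive (matrix_space (n l)) (op_space T) (\<psi> l)) \<and>
      (\<forall>f \<in> dual_carrier (op_space S). (\<lambda>l. \<psi> l (\<phi> l f)) \<longlonglongrightarrow> tensor_map S T u f)"
proof -
  \<comment> \<open>A sequence of positive numbers tending to 0; the shift error then vanishes for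
    each fixed \<open>f\<close>.\<close>
  define e where "e l = inverse (real (Suc l))" for l
  have "\<forall>l. \<exists>n \<phi> \<psi>. 0 < n \<and>
      completely_positive (dual_space (op_space S)) (matrix_space n) \<phi> \<and>
      completely_positive (matrix_space n) (op_space T) \<psi> \<and>
      (\<forall>f \<in> dual_carrier (op_space S). \<psi> (\<phi> f) = tensor_map S T u f + e l *\<^sub>R (f id_blinfun *\<^sub>C id_blinfun))"
    by (intro allI schur_cone_factorization[OF S T u] pos) (simp add: e_def)
  from choice[OF this] obtain n where "\<forall>l. \<exists>\<phi> \<psi>. 0 < n l \<and>
      completely_positive (dual_space (op_space S)) (matrix_space (n l)) \<phi> \<and>
      completely_positive (matrix_space (n l)) (op_space T) \<psi> \<and>
      (\<forall>f \<in> dual_carrier (op_space S). \<psi> (\<phi> f) = tensor_map S T u f + e l *\<^sub>R (f id_blinfun *\<^sub>C id_blinfun))"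
    by (elim exE)
  from choice[OF this] obtain \<phi> where "\<forall>l. \<exists>\<psi>. 0 < n l \<and>
      completely_positive (dual_space (op_space S)) (matrix_space (n l)) (\<phi> l) \<and>
      completely_positive (matrix_space (n l)) (op_space T) \<psi> \<and>
      (\<forall>f \<in> dual_carrier (op_space S). \<psi> (\<phi> l f) = tensor_map S T u f + e l *\<^sub>R (f id_blinfun *\<^sub>C id_blinfun))"
    by (elim exE)
  from choice[OF this] obtain \<psi> where fact: "\<forall>l. 0 < n l \<and>
      completely_positive (dual_space (op_space S)) (matrix_space (n l)) (\<phi> l) \<and>
      completely_positive (matrix_space (n l)) (op_space T) (\<psi> l) \<and>
      (\<forall>f \<in> dual_carrier (op_space S). \<psi> l (\<phi> l f) = tensor_map S T u f + e l *\<^sub>R (f id_blinfun *\<^sub>C id_blinfun))"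
    by (elim exE)
  have "(\<lambda>l. \<psi> l (\<phi> l f)) \<longlonglongrightarrow> tensor_map S T u f" if f: "f \<in> dual_carrier (op_space S)" for f
  proof -
    have "(\<lambda>l. tensor_map S T u f + e l *\<^sub>R (f id_blinfun *\<^sub>C id_blinfun)) \<longlonglongrightarrow>
        tensor_map S T u f + 0 *\<^sub>R (f id_blinfun *\<^sub>C id_blinfun)"
      unfolding e_def by (intro tendsto_intros LIMSEQ_inverse_real_of_nat)
    then show ?thesis using fact f by simp
  qed
  with fact show ?thesis by (intro exI[of _ n] exI[of _ \<phi>] exI[of _ \<psi>]) simp
qed

section \<open>From approximate factorizations to positivity\<close>

lemma tensor_coordinate_expansion:
  fixes S :: "('h::chilbert_space \<Rightarrow>\<^sub>L 'h) set" and T :: "('k::chilbert_space \<Rightarrow>\<^sub>L 'k) set"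
  assumes S: "csubspace S" and g: "\<And>b. b \<in> B \<Longrightarrow> g b \<in> dual_carrier (op_space S)"
    and expand: "\<And>x. x \<in> S \<Longrightarrow> x = (\<Sum>b\<in>B. g b x *\<^sub>C b)" and u: "u \<in> tensor_space S T"
  shows "u = (\<Sum>b\<in>B. b \<otimes>\<^sub>t tensor_map S T u (g b))"
proof -
  obtain ps where ps: "set ps \<subseteq> S \<times> T" "u = (\<Sum>(x, y)\<leftarrow>ps. x \<otimes>\<^sub>t y)"
    using tensor_space_list[OF S u] by blast
  have "(\<Sum>(x, y)\<leftarrow>ps. x \<otimes>\<^sub>t y) = (\<Sum>b\<in>B. b \<otimes>\<^sub>t (\<Sum>(x, y)\<leftarrow>ps. g b x *\<^sub>C y))"
    using ps(1)
  proof (induction ps)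
    case (Cons p ps)
    obtain x y where p: "p = (x, y)" "x \<in> S" using Cons.prems by (cases p) auto
    have "x \<otimes>\<^sub>t y = (\<Sum>b\<in>B. b \<otimes>\<^sub>t (g b x *\<^sub>C y))"
      by (subst expand[OF p(2)])
        (simp add: tensor_pure_sum_left tensor_pure_scaleC_left tensor_pure_scaleC_right)
    with Cons show ?case by (simp add: p tensor_pure_add_right sum.distrib)
  qed simp
  then show ?thesis
    using tensor_map_list[OF S g ps(1)] by (simp add: ps(2))
qed

lemma tensor_map_in:
  fixes S :: "('h::chilbert_space \<Rightarrow>\<^sub>L 'h) set" and T :: "('k::chilbert_space \<Rightarrow>\<^sub>L 'k) set"
  assumes S: "csubspace S" and T: "csubspace T" and f: "f \<in> dual_carrier (op_space S)" and u: "u \<in> tensor_space S T"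
  shows "tensor_map S T u f \<in> T"
proof -
  obtain ps where ps: "set ps \<subseteq> S \<times> T" "u = (\<Sum>(x, y)\<leftarrow>ps. x \<otimes>\<^sub>t y)"
    using tensor_space_list[OF S u] by blast
  have "(\<Sum>(x, y)\<leftarrow>ps. f x *\<^sub>C y) \<in> T"
    using ps(1) T by (induction ps)
      (auto simp: complex_vector.subspace_0 intro!: complex_vector.subspace_add complex_vector.subspace_scale)
  then show ?thesis
    unfolding ps(2) tensor_map_list[OF S f ps(1)] .
qed

text \<open>Expresses a Schur sum in the basis of \<open>S\<close> by the values of its induced map
  at the coordinate functionals, so that it can be compared with \<open>u\<close> one basis element
  at a time.\<close>

lemma schur_coordinate_expansion:
  assumes expand: "\<And>x. x \<in> S \<Longrightarrow> x = (\<Sum>b\<in>B. g b x *\<^sub>C b)" and P: "P \<in> op_cone S n"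
  shows "(\<Sum>i<n. \<Sum>j<n. P $$ (i, j) \<otimes>\<^sub>t Q $$ (i, j)) =
    (\<Sum>b\<in>B. b \<otimes>\<^sub>t (\<Sum>i<n. \<Sum>j<n. g b (P $$ (i, j)) *\<^sub>C Q $$ (i, j)))"
proof -
  have "(\<Sum>i<n. \<Sum>j<n. P $$ (i, j) \<otimes>\<^sub>t Q $$ (i, j)) =
      (\<Sum>i<n. \<Sum>j<n. \<Sum>b\<in>B. b \<otimes>\<^sub>t (g b (P $$ (i, j)) *\<^sub>C Q $$ (i, j)))"
  proof (intro sum.cong refl)
    fix i j assume "i \<in> {..<n}" "j \<in> {..<n}"
    then show "P $$ (i, j) \<otimes>\<^sub>t Q $$ (i, j) = (\<Sum>b\<in>B. b \<otimes>\<^sub>t (g b (P $$ (i, j)) *\<^sub>C Q $$ (i, j)))"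
      by (subst expand[OF op_coneD(2)[OF P]])
        (simp_all add: tensor_pure_sum_left tensor_pure_scaleC_left tensor_pure_scaleC_right)
  qed
  also have "\<dots> = (\<Sum>b\<in>B. \<Sum>i<n. \<Sum>j<n. b \<otimes>\<^sub>t (g b (P $$ (i, j)) *\<^sub>C Q $$ (i, j)))"
    by (subst sum.swap[of _ B]) (intro sum.cong refl sum.swap)
  finally show ?thesis by (simp add: tensor_pure_sum_right)
qed

text \<open>Taking adjoints transposes the entries of \<open>P\<close> and \<open>Q\<close> and
  conjugates the values of \<open>f\<close>, so it only swaps \<open>i\<close> and \<open>j\<close>
  in the double sum.\<close>

lemma schur_map_self_adjoint:
  assumes S: "operator_system S" and T: "operator_system T" and P: "P \<in> op_cone S n" and Q: "Q \<in> op_cone T n"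
    and f: "\<And>x y. x \<in> S \<Longrightarrow> y \<in> S \<Longrightarrow> is_adjoint x y \<Longrightarrow> f y = cnj (f x)"
  shows "is_adjoint (\<Sum>i<n. \<Sum>j<n. f (P $$ (i, j)) *\<^sub>C Q $$ (i, j)) (\<Sum>i<n. \<Sum>j<n. f (P $$ (i, j)) *\<^sub>C Q $$ (i, j))"
proof -
  have "is_adjoint (\<Sum>i<n. \<Sum>j<n. f (P $$ (i, j)) *\<^sub>C Q $$ (i, j)) (\<Sum>i<n. \<Sum>j<n. f (P $$ (j, i)) *\<^sub>C Q $$ (j, i))"
  proof (intro is_adjoint_sum)
    fix i j assume "i \<in> {..<n}" "j \<in> {..<n}"
    then have ij: "i < n" "j < n" by auto
    have "f (P $$ (j, i)) = cnj (f (P $$ (i, j)))"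
      using ij by (intro f op_cone_is_adjoint[OF S P] op_coneD(2)[OF P])
    then show "is_adjoint (f (P $$ (i, j)) *\<^sub>C Q $$ (i, j)) (f (P $$ (j, i)) *\<^sub>C Q $$ (j, i))"
      using is_adjoint_scaleC[OF op_cone_is_adjoint[OF T Q ij]] by simp
  qed
  then show ?thesis by (subst (asm) (2) sum.swap)
qed

text \<open>Biduality supplies \<open>P\<close> from \<open>\<phi>\<close>, and the Choi matrix of
  \<open>\<psi>\<close> supplies \<open>Q\<close>.\<close>

lemma cp_composition_schur:
  fixes S :: "('h::chilbert_space \<Rightarrow>\<^sub>L 'h) set" and T :: "('k::chilbert_space \<Rightarrow>\<^sub>L 'k) set"
  assumes S: "operator_system S" "finite_dimensional S"
    and \<phi>: "completely_positive (dual_space (op_space S)) (matrix_space n) \<phi>"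
    and \<psi>: "completely_positive (matrix_space n) (op_space T) \<psi>"
  shows "\<exists>P\<in>op_cone S n. \<exists>Q\<in>op_cone T n. \<forall>f\<in>dual_carrier (op_space S).
    \<psi> (\<phi> f) = (\<Sum>i<n. \<Sum>j<n. f (P $$ (i, j)) *\<^sub>C Q $$ (i, j))"
proof -
  obtain P where P: "P \<in> op_cone S n" "\<And>f. f \<in> dual_carrier (op_space S) \<Longrightarrow> \<phi> f = map_mat f P"
    using completely_positive_dual_matrix[OF S \<phi>] by blast
  let ?Q = "mat n n (\<lambda>(a, b). \<psi> (matrix_unit n a b))"
  have lin: "mo_linear (matrix_space n) (op_space T) \<psi>"
    using \<psi> by (simp add: completely_positive_def)
  have "\<psi> (\<phi> f) = (\<Sum>i<n. \<Sum>j<n. f (P $$ (i, j)) *\<^sub>C ?Q $$ (i, j))"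
    if "f \<in> dual_carrier (op_space S)" for f
    using mo_linear_matrix_expansion[OF lin, of "map_mat f P"] op_coneD(1)[OF P(1)] P(2)[OF that]
    by (simp cong: sum.cong_simp)
  then show ?thesis
    using P(1) choi_matrix_positive[OF \<psi>] by blast
qed

text \<open>Since \<open>S\<close> is finite dimensional, convergence at the finitely many
  coordinate functionals bounds the whole error tensor. At one good index it is absorbed by the
  shift \<open>e\<close>, leaving a Schur sum.\<close>

lemma approximate_factorization_positive:
  fixes S :: "('h::chilbert_space \<Rightarrow>\<^sub>L 'h) set" and T :: "('k::chilbert_space \<Rightarrow>\<^sub>L 'k) set"
  assumes S: "operator_system S" "finite_dimensional S" and T: "operator_system T" and u: "u \<in> tensor_space S T"
    and dir: "directed_set \<Lambda> leq"
    and cp: "\<And>l. l \<in> \<Lambda> \<Longrightarrow> 0 < n l \<and>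
        completely_positive (dual_space (op_space S)) (matrix_space (n l)) (\<phi> l) \<and>
        completely_positive (matrix_space (n l)) (op_space T) (\<psi> l)"
    and lim: "\<And>f. f \<in> dual_carrier (op_space S) \<Longrightarrow>
        ((\<lambda>l. \<psi> l (\<phi> l f)) \<longlongrightarrow> tensor_map S T u f) (net_filter \<Lambda> leq)"
    and "0 < e"
  shows "e *\<^sub>R tensor_one + u \<in> schur_cone S T"
proof -
  obtain B g where B: "finite B" "B \<subseteq> S" "\<And>b. b \<in> B \<Longrightarrow> is_adjoint b b"
    and g: "\<And>b. b \<in> B \<Longrightarrow> g b \<in> dual_carrier (op_space S)"
    and expand: "\<And>x. x \<in> S \<Longrightarrow> x = (\<Sum>b\<in>B. g b x *\<^sub>C b)"
    and g_adj: "\<And>x y b. x \<in> S \<Longrightarrow> y \<in> S \<Longrightarrow> is_adjoint x y \<Longrightarrow> b \<in> B \<Longrightarrow> g b y = cnj (g b x)"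
    by (rule hermitian_coordinates[OF S]) (rule that, assumption+)
  note subS = operator_systemD(1)[OF S(1)] and subT = operator_systemD(1)[OF T]
  let ?F = "net_filter \<Lambda> leq"
  have schur: "\<exists>P\<in>op_cone S (n l). \<exists>Q\<in>op_cone T (n l). \<forall>f\<in>dual_carrier (op_space S).
      \<psi> l (\<phi> l f) = (\<Sum>i<n l. \<Sum>j<n l. f (P $$ (i, j)) *\<^sub>C Q $$ (i, j))" if "l \<in> \<Lambda>" for l
    using cp_composition_schur[OF S] cp[OF that] by blast
  have adj: "is_adjoint (\<psi> l (\<phi> l (g b))) (\<psi> l (\<phi> l (g b)))" if l: "l \<in> \<Lambda>" and b: "b \<in> B" for l b
  proof -
    obtain P Q where P: "P \<in> op_cone S (n l)" and Q: "Q \<in> op_cone T (n l)"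
      and eq: "\<psi> l (\<phi> l (g b)) = (\<Sum>i<n l. \<Sum>j<n l. g b (P $$ (i, j)) *\<^sub>C Q $$ (i, j))"
      using schur[OF l] g[OF b] by blast
    show ?thesis unfolding eq by (rule schur_map_self_adjoint[OF S(1) T P Q]) (use g_adj b in blast)
  qed
  have "\<Lambda> \<noteq> {}" and leq_refl: "\<And>a. a \<in> \<Lambda> \<Longrightarrow> leq a a"
    using dir by (simp_all add: directed_set_def)
  then obtain l\<^sub>0 where "l\<^sub>0 \<in> \<Lambda>" by blast
  \<comment> \<open>By reflexivity each index lies in its own tail, so no tail is empty.\<close>
  have "\<not> eventually (\<lambda>_. False) ?F"
    unfolding eventually_net_filter[OF dir] using leq_refl by blast
  then have F: "?F \<noteq> bot" by (simp add: eventually_False)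
  have adj_ev: "\<forall>\<^sub>F l in ?F. is_adjoint (\<psi> l (\<phi> l (g b))) (\<psi> l (\<phi> l (g b)))" if "b \<in> B" for b
    using adj that \<open>l\<^sub>0 \<in> \<Lambda>\<close> by (auto simp: eventually_net_filter[OF dir])
  \<comment> \<open>The order unit estimate applies to self-adjoint legs only, hence both the
    approximants and their limits must be self-adjoint.\<close>
  have t_adj: "is_adjoint (tensor_map S T u (g b)) (tensor_map S T u (g b))" if "b \<in> B" for b
    by (rule is_adjoint_tendsto[OF lim lim F adj_ev]) (use g that in auto)
  define d where "d l b = tensor_map S T u (g b) - \<psi> l (\<phi> l (g b))" for l b
  \<comment> \<open>This weighted sum is the total multiple of \<open>tensor_one\<close> that the
    order unit estimate spends on the error terms \<open>b \<otimes>\<^sub>t d l b\<close>.\<close>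
  have "((\<lambda>l. \<Sum>b\<in>B. norm b * norm (d l b)) \<longlongrightarrow>
      (\<Sum>b\<in>B. norm b * norm (tensor_map S T u (g b) - tensor_map S T u (g b)))) ?F"
    unfolding d_def by (intro tendsto_intros lim g)
  then have "\<forall>\<^sub>F l in ?F. (\<Sum>b\<in>B. norm b * norm (d l b)) < e"
    using \<open>0 < e\<close> by (intro order_tendstoD(2)) auto
  then obtain l where l: "l \<in> \<Lambda>" and small: "(\<Sum>b\<in>B. norm b * norm (d l b)) < e"
    unfolding eventually_net_filter[OF dir] using leq_refl by blast
  obtain P Q where P: "P \<in> op_cone S (n l)" and Q: "Q \<in> op_cone T (n l)"
    and eq: "\<And>f. f \<in> dual_carrier (op_space S) \<Longrightarrow>
      \<psi> l (\<phi> l f) = (\<Sum>i<n l. \<Sum>j<n l. f (P $$ (i, j)) *\<^sub>C Q $$ (i, j))"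
    using schur[OF l] by blast
  define w where "w = (\<Sum>i<n l. \<Sum>j<n l. P $$ (i, j) \<otimes>\<^sub>t Q $$ (i, j))"
  have "w = (\<Sum>b\<in>B. b \<otimes>\<^sub>t (\<Sum>i<n l. \<Sum>j<n l. g b (P $$ (i, j)) *\<^sub>C Q $$ (i, j)))"
    unfolding w_def by (rule schur_coordinate_expansion[OF expand P])
  also have "\<dots> = (\<Sum>b\<in>B. b \<otimes>\<^sub>t \<psi> l (\<phi> l (g b)))"
    by (intro sum.cong refl) (simp add: eq[OF g])
  finally have w_eq: "(\<Sum>b\<in>B. b \<otimes>\<^sub>t \<psi> l (\<phi> l (g b))) = w" by simp
  have "(\<Sum>b\<in>B. b \<otimes>\<^sub>t tensor_map S T u (g b)) = u"
    by (rule tensor_coordinate_expansion[OF subS g expand u, symmetric])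
  then have u_eq: "u = w + (\<Sum>b\<in>B. b \<otimes>\<^sub>t d l b)"
    by (simp add: d_def tensor_pure_diff_right sum_subtractf w_eq)
  have "(norm b * norm (d l b)) *\<^sub>R tensor_one + b \<otimes>\<^sub>t d l b \<in> schur_cone S T" if "b \<in> B" for b
  proof (rule schur_cone_order_unit[OF S(1) T])
    have "\<psi> l (\<phi> l (g b)) \<in> T"
      unfolding eq[OF g[OF that]] using op_coneD(2)[OF Q] subT
      by (intro complex_vector.subspace_sum complex_vector.subspace_scale) auto
    then show "d l b \<in> T"
      unfolding d_def using tensor_map_in[OF subS subT g[OF that] u] subT
      by (intro complex_vector.subspace_diff)
    show "is_adjoint (d l b) (d l b)"
      unfolding d_def by (intro is_adjoint_diff t_adj adj l that)
  qed (use B that in auto)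
  then have "(\<Sum>b\<in>B. (norm b * norm (d l b)) *\<^sub>R tensor_one + b \<otimes>\<^sub>t d l b) \<in> schur_cone S T"
    by (intro schur_cone_sum complex_vector.subspace_0 subS subT)
  moreover have "w \<in> schur_cone S T"
    unfolding w_def schur_cone_def using P Q cp[OF l] by blast
  \<comment> \<open>The part of \<open>e\<close> left over after every error term has taken its
    share.\<close>
  moreover have "(e - (\<Sum>b\<in>B. norm b * norm (d l b))) *\<^sub>R tensor_one \<in> schur_cone S T"
    using small by (intro schur_cone_one S(1) T) simp
  ultimately have "(e - (\<Sum>b\<in>B. norm b * norm (d l b))) *\<^sub>R tensor_one +
      (w + (\<Sum>b\<in>B. (norm b * norm (d l b)) *\<^sub>R tensor_one + b \<otimes>\<^sub>t d l b)) \<in> schur_cone S T"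
    by (intro schur_cone_add complex_vector.subspace_0 subS subT)
  then show ?thesis
    by (simp add: u_eq sum.distrib scaleR_left_diff_distrib flip: scaleR_sum_left)
qed

theorem theorem16:
  fixes S :: "('h::chilbert_space \<Rightarrow>\<^sub>L 'h) set"
    and T :: "('k::chilbert_space \<Rightarrow>\<^sub>L 'k) set"
    and u :: "('h \<Rightarrow>\<^sub>L 'h, 'k \<Rightarrow>\<^sub>L 'k) tensor"
  assumes "operator_system S" and "finite_dimensional S"
    and "operator_system T" and "finite_dimensional T"
    and "u \<in> tensor_space S T"
  shows "mo_positive (max_tensor S T) u \<longleftrightarrow>
    (\<exists>(\<Lambda> :: 'i::infinite set) leq n \<phi> \<psi>.
      directed_set \<Lambda> leq \<and>
      (\<forall>l\<in>\<Lambda>. 0 < n l \<and>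
        completely_positive (dual_space (op_space S)) (matrix_space (n l)) (\<phi> l) \<and>
        completely_positive (matrix_space (n l)) (op_space T) (\<psi> l)) \<and>
      (\<forall>f \<in> mcarrier (dual_space (op_space S)).
        ((\<lambda>l. \<psi> l (\<phi> l f)) \<longlongrightarrow> tensor_map S T u f) (net_filter \<Lambda> leq)))"
    (is "_ \<longleftrightarrow> ?factors")
proof
  assume "mo_positive (max_tensor S T) u"
  then have "\<forall>e>0. e *\<^sub>R tensor_one + u \<in> schur_cone S T"
    using mo_positive_max_tensor_iff assms(3,5) by blast
  then have "\<exists>(n :: nat \<Rightarrow> nat) \<phi> \<psi>.
      (\<forall>l. 0 < n l \<and>
        completely_positive (dual_space (op_space S)) (matrix_space (n l)) (\<phi> l) \<and>
        completely_positive (matrix_space (n l)) (op_space T) (\<psi> l)) \<and>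
      (\<forall>f \<in> dual_carrier (op_space S). (\<lambda>l. \<psi> l (\<phi> l f)) \<longlonglongrightarrow> tensor_map S T u f)"
    by (intro positive_approximate_factorization[OF assms(1,3,5)]) simp
  then obtain n \<phi> \<psi> where cp: "\<And>l :: nat. 0 < n l \<and>
        completely_positive (dual_space (op_space S)) (matrix_space (n l)) (\<phi> l) \<and>
        completely_positive (matrix_space (n l)) (op_space T) (\<psi> l)"
    and lim: "\<And>f. f \<in> dual_carrier (op_space S) \<Longrightarrow> (\<lambda>l. \<psi> l (\<phi> l f)) \<longlonglongrightarrow> tensor_map S T u f"
    by blast
  \<comment> \<open>The sequence of factorizations is copied into the infinite index type along an
    injection.\<close>
  obtain r :: "nat \<Rightarrow> 'i" where r: "inj r"
    using infinite_countable_subset[OF infinite_UNIV] by blast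
  let ?leq = "\<lambda>i j. inv_into UNIV r i \<le> inv_into UNIV r j"
  have "((\<lambda>i. \<psi> (inv_into UNIV r i) (\<phi> (inv_into UNIV r i) f)) \<longlongrightarrow> tensor_map S T u f) (net_filter (range r) ?leq)"
    if "f \<in> dual_carrier (op_space S)" for f
    by (rule tendsto_net_filter_range(1)[OF r]) (use lim[OF that] r in simp)
  then show ?factors
    using cp tendsto_net_filter_range(2)[OF r tendsto_const]
    by (intro exI[of _ "range r"] exI[of _ ?leq] exI[of _ "\<lambda>i. n (inv_into UNIV r i)"]
        exI[of _ "\<lambda>i. \<phi> (inv_into UNIV r i)"] exI[of _ "\<lambda>i. \<psi> (inv_into UNIV r i)"]) (auto simp: dual_space_simps)
next
  assume ?factors
  then obtain \<Lambda> :: "'i set" and leq n \<phi> \<psi> where dir: "directed_set \<Lambda> leq"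
    and cp: "\<And>l. l \<in> \<Lambda> \<Longrightarrow> 0 < n l \<and>
        completely_positive (dual_space (op_space S)) (matrix_space (n l)) (\<phi> l) \<and>
        completely_positive (matrix_space (n l)) (op_space T) (\<psi> l)"
    and lim: "\<And>f. f \<in> dual_carrier (op_space S) \<Longrightarrow>
        ((\<lambda>l. \<psi> l (\<phi> l f)) \<longlongrightarrow> tensor_map S T u f) (net_filter \<Lambda> leq)"
    unfolding dual_space_simps by blast
  have "\<forall>e>0. e *\<^sub>R tensor_one + u \<in> schur_cone S T"
    using approximate_factorization_positive[OF assms(1,2,3,5) dir cp lim] by blast
  then show "mo_positive (max_tensor S T) u"
    by (simp add: mo_positive_max_tensor_iff[OF assms(3,5)])
qed

end
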